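(* Let $G$ be a smooth function, let $m_G$ be defined implicitly by $x=\pi\int_{\sqrt{m_G(x)}}^{+\infty}\eta(it/2)^4G(R(e^{-\pi t}))dt$, and put $y(A)=R\!\left(e^{-\pi\sqrt{m_G(A)}}\right)$. Regarding $A$ as a function of $k_{m_G}:=k_{m_G(A)}$, one has $$\frac{dA}{dk_{m_G}}=\sqrt[3]{2}\,\frac{G\left(y(A)\right)}{\left(k_{m_G}k'_{m_G}\right)^{2/3}} .$$
   Context: $\eta(\tau)=e^{\pi i\tau/12}\prod_{n\ge1}(1-e^{2\pi i n\tau})$ is the Dedekind eta function; $R(q)=\cfrac{q^{1/5}}{1+\cfrac{q}{1+\cfrac{q^2}{1+\cdots}}}$ ($0<q<1$) is the Rogers–Ramanujan continued fraction. For $r>0$, the elliptic singular modulus $k_r\in(0,1)$ is defined by $K\!\left(\sqrt{1-k_r^2}\right)/K(k_r)=\sqrt r$, where $K(k)=\int_0^{\pi/2}\frac{d\theta}{\sqrt{1-k^2\sin^2\theta}}$, and $k'_r=\sqrt{1-k_r^2}$. *)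

theory Defs
  imports "HOL-Analysis.Analysis"
begin

definition smooth_fun :: "(real \<Rightarrow> real) \<Rightarrow> bool" where
  "smooth_fun G \<longleftrightarrow> (\<forall>n. \<forall>x. ((deriv ^^ n) G) differentiable (at x))"

definition dedekind_eta :: "complex \<Rightarrow> complex" where
  "dedekind_eta \<tau> = exp (pi * \<i> * \<tau> / 12) *
     (\<Prod>n. (1 - exp (2 * pi * \<i> * of_nat (Suc n) * \<tau>)))"

fun rr_tail :: "real \<Rightarrow> nat \<Rightarrow> nat \<Rightarrow> real" where
  "rr_tail q k 0 = 1"
| "rr_tail q k (Suc N) = 1 + q ^ k / rr_tail q (Suc k) N"

definition rogers_ramanujan :: "real \<Rightarrow> real" where
  "rogers_ramanujan q = q powr (1/5) / lim (\<lambda>N. rr_tail q 1 N)"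

definition ellK :: "real \<Rightarrow> real" where
  "ellK k = integral {0..pi/2} (\<lambda>\<theta>. 1 / sqrt (1 - k\<^sup>2 * (sin \<theta>)\<^sup>2))"

definition sing_mod :: "real \<Rightarrow> real" where
  "sing_mod r = (THE k. 0 < k \<and> k < 1 \<and> ellK (sqrt (1 - k\<^sup>2)) / ellK k = sqrt r)"

definition sing_mod_inv :: "real \<Rightarrow> real" where
  "sing_mod_inv k = (THE r. 0 < r \<and> sing_mod r = k)"

definition FG :: "(real \<Rightarrow> real) \<Rightarrow> real \<Rightarrow> complex" where
  "FG G m = pi * integral {sqrt m..}
     (\<lambda>t. (dedekind_eta (\<i> * of_real t / 2)) ^ 4 * of_real (G (rogers_ramanujan (exp (- pi * t)))))"

end

(*
  Let N(b) be the integral of 1 / sqrt (cos^2 t + b^2 sin^2 t) over [0, pi/2], so that K(k) = N(k')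
  and K(k') = N(k), put T(k) = N(k) / N(k'), and let L(k) = (1 - k') / (1 + k') be Landen's map.
  Landen's transformation gives T(L k) = 2 T(k). Hence the expression in Legendre's relation is
  invariant under L, and its limit at 0 yields T'(k) = - pi / (2 k k'^2 K(k)^2).

  On the other side, the theta functions theta_4^2 / theta_3^2 = k' define a modulus as a function
  of the nome q, and the passage from q to q^2 is again Landen's map. A function f on (0,1) with
  f(q^2) = 2 f(q) that is bounded near 0 vanishes; this rigidity identifies q with exp(- pi T(k)),
  gives the product formula for k, and together with Jacobi's triple product at z = 1 and z = -1
  expresses eta(i T / 2)^4 through k, k' and K(k). The derivative of the tail integral in the
  statement is then computed by the chain rule.
*)
theory Submission
  imports Defs
begin

section \<open>Complete elliptic integrals and the Landen transformation\<close>

text \<open>The integrand lives in the nome, the answer in the modulus. T'(k) brings in K(k)^(-2),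
  and eta^4 carries the same transcendental factor as K^2, so the two cancel and an algebraic
  function of k remains; the exponent 2/3 and the cube root of 2 arise because k k' is 4 q^(1/2)
  over a twelfth power. The argument i t / 2 makes q = exp(- pi t) the base of the eta product, and
  this q is also the nome of the modulus and the argument of R. The obstacle is the singular end k =
  0, where T and ln q are both logarithmically infinite. Each is compared with 2 ln k up to a
  bounded error, and crude constants suffice there, since rigidity turns boundedness into equality.
  The values that must be exact are N(1) = pi/2 and the limit 1 of - b N'(b) at b = 0, both
  elementary. The composite of G and R enters through its continuity and a bound for G on [0, 1],
  which with the exponential decay of eta^4 makes the tail integrals converge.\<close>

definition ellD :: "real \<Rightarrow> real \<Rightarrow> real" where
  "ellD b t = (cos t)\<^sup>2 + b\<^sup>2 * (sin t)\<^sup>2"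

definition ellN :: "real \<Rightarrow> real" where
  "ellN b = integral {0..pi/2} (\<lambda>t. 1 / sqrt (ellD b t))"

text \<open>Minus b times the derivative of \<open>ellN\<close>; for b < 1 it is (E - b^2 K) / (1 -
  b^2) at the modulus complementary to b. The scaling keeps it between 0 and 1 with limit 1 at b =
  0, which is why \<open>ellN b\<close> grows like - ln b.\<close>

definition ellJ :: "real \<Rightarrow> real" where
  "ellJ b = integral {0..pi/2} (\<lambda>t. b\<^sup>2 * (sin t)\<^sup>2 / (ellD b t * sqrt (ellD b t)))"

lemma ellD_pos: "0 < b \<Longrightarrow> 0 < ellD b t"
proof (cases "sin t = 0")
  case True
  then show ?thesis
    using sin_cos_squared_add[of t] by (simp add: ellD_def)
next
  case False
  assume "0 < b"
  with False have "0 < b\<^sup>2 * (sin t)\<^sup>2" by simp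
  then show ?thesis unfolding ellD_def by (rule add_nonneg_pos[OF zero_le_power2])
qed

lemma continuous_on_ellD [continuous_intros]:
  fixes f g :: "'a::t2_space \<Rightarrow> real"
  shows "continuous_on A f \<Longrightarrow> continuous_on A g \<Longrightarrow> continuous_on A (\<lambda>x. ellD (f x) (g x))"
  unfolding ellD_def by (intro continuous_intros)

lemma ellK_eq_ellN:
  assumes "0 \<le> k" "k \<le> 1"
  shows "ellK k = ellN (sqrt (1 - k\<^sup>2))"
proof -
  have "1 - k\<^sup>2 * (sin t)\<^sup>2 = ellD (sqrt (1 - k\<^sup>2)) t" for t
    using assms by (simp add: ellD_def cos_squared_eq algebra_simps abs_square_le_1)
  then show ?thesis by (simp add: ellK_def ellN_def)
qed

lemma ellD_bounds:
  assumes "0 < b" "b \<le> 1"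
  shows "b\<^sup>2 \<le> ellD b t" "ellD b t \<le> 1" "(cos t)\<^sup>2 \<le> ellD b t"
proof -
  have b: "b\<^sup>2 \<le> 1" using assms by (simp add: abs_square_le_1)
  have e: "ellD b t = b\<^sup>2 + (1 - b\<^sup>2) * (cos t)\<^sup>2"
    by (simp add: ellD_def sin_squared_eq algebra_simps)
  have e': "ellD b t = 1 - (1 - b\<^sup>2) * (sin t)\<^sup>2"
    by (simp add: ellD_def cos_squared_eq algebra_simps)
  show "b\<^sup>2 \<le> ellD b t" unfolding e using b by simp
  show "ellD b t \<le> 1" unfolding e' using b by simp
  show "(cos t)\<^sup>2 \<le> ellD b t" unfolding ellD_def by simp
qed

lemma ellN_integrand_integrable:
  "0 < b \<Longrightarrow> (\<lambda>t. 1 / sqrt (ellD b t)) integrable_on {c..d}"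
  using ellD_pos[of b] by (intro integrable_continuous_real continuous_intros)
     (auto simp: less_imp_neq[OF ellD_pos, THEN not_sym])

lemma ellJ_integrand_integrable:
  "0 < b \<Longrightarrow> (\<lambda>t. b\<^sup>2 * (sin t)\<^sup>2 / (ellD b t * sqrt (ellD b t))) integrable_on {c..d}"
  by (intro integrable_continuous_real continuous_intros)
     (auto simp: less_imp_neq[OF ellD_pos, THEN not_sym])

lemma ellN_has_real_derivative:
  assumes "0 < b"
  shows "(ellN has_real_derivative - ellJ b / b) (at b)"
proof -
  define fx where "fx = (\<lambda>x t. - x * (sin t)\<^sup>2 / (ellD x t * sqrt (ellD x t)))"
  have pos: "0 < ellD x t" if "x \<in> {0<..}" for x t using that by (simp add: ellD_pos)
  have d: "((\<lambda>x. 1 / sqrt (ellD x t)) has_real_derivative fx x t) (at x within {0<..})"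
    if "x \<in> {0<..}" for x t
  proof -
    have e: "((\<lambda>x. ellD x t) has_real_derivative 2 * x * (sin t)\<^sup>2) (at x within {0<..})"
      unfolding ellD_def by (auto intro!: derivative_eq_intros)
    have p: "0 < sqrt (ellD x t)" "sqrt (ellD x t) * sqrt (ellD x t) = ellD x t"
      using pos[OF that, of t] by auto
    show ?thesis using pos[OF that, of t] p
      unfolding fx_def by (auto intro!: derivative_eq_intros e simp: field_simps)
  qed
  have "((\<lambda>x. integral (cbox 0 (pi/2)) (\<lambda>t. 1 / sqrt (ellD x t))) has_field_derivative
          integral (cbox 0 (pi/2)) (fx b)) (at b within {0<..})"
  proof (rule leibniz_rule_field_derivative[OF d])
    show "continuous_on ({0<..} \<times> cbox 0 (pi/2)) (\<lambda>(x, t). fx x t)"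
      unfolding fx_def case_prod_beta
      by (intro continuous_intros) (auto simp: less_imp_neq[OF ellD_pos, THEN not_sym])
  qed (use assms ellN_integrand_integrable in auto)
  moreover have "integral (cbox 0 (pi/2)) (fx b) = - ellJ b / b"
  proof -
    have "fx b = (\<lambda>t. (- 1 / b) * (b\<^sup>2 * (sin t)\<^sup>2 / (ellD b t * sqrt (ellD b t))))"
      using assms by (auto simp: fx_def power2_eq_square)
    then have "integral (cbox 0 (pi/2)) (fx b) = (- 1 / b) * ellJ b"
      unfolding ellJ_def by (simp only: integral_mult_right cbox_interval)
    then show ?thesis by simp
  qed
  moreover have "at b within {0<..} = at b"
    using assms by (intro at_within_open) auto
  ultimately show ?thesis
    by (simp add: ellN_def[abs_def] cbox_interval)
qed

text \<open>With D = \<open>ellD b t\<close>, the comparison function b^2 sin t / D^(3/2) has the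
  primitive - cos t / sqrt D and integral exactly 1. Passing from sin t to its square loses sin t (1
  - sin t) <= cos^2 t <= D, so the integrand drops by at most b^2 / sqrt D <= b.\<close>

lemma ellJ_bounds:
  assumes "0 < b" "b \<le> 1"
  shows "0 \<le> ellJ b" "ellJ b \<le> 1" "1 - ellJ b \<le> b * pi / 2"
proof -
  define S where "S = (\<lambda>t. sqrt (ellD b t))"
  have S: "0 < S t" "(S t)\<^sup>2 = ellD b t" "b \<le> S t" "S t * S t = ellD b t" for t
    using ellD_pos[OF assms(1), of t] ellD_bounds(1)[OF assms, of t] assms
    by (auto simp: S_def real_le_rsqrt)
  have "((\<lambda>t. b\<^sup>2 * sin t / (ellD b t * S t)) has_integral (- cos (pi/2) / S (pi/2) - (- cos 0 / S 0))) {0..pi/2}"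
  proof (rule fundamental_theorem_of_calculus)
    fix t assume "t \<in> {0..pi/2}"
    have e: "(ellD b has_real_derivative - 2 * (1 - b\<^sup>2) * sin t * cos t) (at t within {0..pi/2})"
      unfolding ellD_def[abs_def] by (auto intro!: derivative_eq_intros simp: algebra_simps)
    have f: "(S has_real_derivative (- 2 * (1 - b\<^sup>2) * sin t * cos t) / (2 * S t)) (at t within {0..pi/2})"
      unfolding S_def using ellD_pos[OF assms(1), of t]
      by (auto intro!: derivative_eq_intros e simp: field_simps)
    have "((\<lambda>t. - cos t / S t) has_real_derivative
        (sin t * S t - (- cos t) * ((- 2 * (1 - b\<^sup>2) * sin t * cos t) / (2 * S t))) / (S t * S t)) (at t within {0..pi/2})"
    proof (rule DERIV_divide)
      show "((\<lambda>t. - cos t) has_real_derivative sin t) (at t within {0..pi/2})"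
        by (auto intro!: derivative_eq_intros)
    qed (use f S(1)[of t] in auto)
    moreover have "(sin t * S t - (- cos t) * ((- 2 * (1 - b\<^sup>2) * sin t * cos t) / (2 * S t))) / (S t * S t)
       = b\<^sup>2 * sin t / (ellD b t * S t)"
    proof -
      have "(sin t * S t - (- cos t) * ((- 2 * (1 - b\<^sup>2) * sin t * cos t) / (2 * S t))) / (S t * S t)
        = sin t * ((S t)\<^sup>2 - (1 - b\<^sup>2) * (cos t)\<^sup>2) / (S t * S t * S t)"
        using S(1)[of t] by (simp add: field_simps power2_eq_square)
      also have "(S t)\<^sup>2 - (1 - b\<^sup>2) * (cos t)\<^sup>2 = b\<^sup>2"
        by (simp add: S(2) ellD_def cos_squared_eq algebra_simps)
      finally show ?thesis by (simp add: S(4) mult.commute)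
    qed
    ultimately show "((\<lambda>t. - cos t / S t) has_vector_derivative b\<^sup>2 * sin t / (ellD b t * S t)) (at t within {0..pi/2})"
      by (simp add: has_real_derivative_iff_has_vector_derivative)
  qed simp
  then have i1: "((\<lambda>t. b\<^sup>2 * sin t / (ellD b t * S t)) has_integral 1) {0..pi/2}"
    by (simp add: S_def ellD_def)
  have i2: "((\<lambda>t. b\<^sup>2 * (sin t)\<^sup>2 / (ellD b t * S t)) has_integral ellJ b) {0..pi/2}"
    unfolding ellJ_def S_def using ellJ_integrand_integrable[OF assms(1)] by (rule integrable_integral)
  have sin: "0 \<le> sin t" "(sin t)\<^sup>2 \<le> sin t" "sin t \<le> 1" if "t \<in> {0..pi/2}" for t
    using that sin_ge_zero[of t] sin_le_one[of t] mult_left_le[of "sin t" "sin t"]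
    by (auto simp: power2_eq_square)
  have Dp: "0 < ellD b t" for t using ellD_pos[OF assms(1)] .
  show "0 \<le> ellJ b"
    using S Dp by (intro has_integral_nonneg[OF i2]) (auto intro!: divide_nonneg_nonneg simp: less_imp_le)
  show "ellJ b \<le> 1"
    using S Dp sin by (intro has_integral_le[OF i2 i1] divide_right_mono mult_left_mono) (auto simp: less_imp_le)
  have "1 - ellJ b \<le> b * (pi/2)"
  proof (rule has_integral_le[OF has_integral_diff[OF i1 i2]])
    show "((\<lambda>t. b) has_integral b * (pi/2)) {0..pi/2}"
      using has_integral_const_real[of b 0 "pi/2"] by (simp add: mult.commute)
    fix t :: real assume t: "t \<in> {0..pi/2}"
    have "b\<^sup>2 * sin t / (ellD b t * S t) - b\<^sup>2 * (sin t)\<^sup>2 / (ellD b t * S t)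
        = b\<^sup>2 * (sin t * (1 - sin t)) / (ellD b t * S t)"
      by (simp add: diff_divide_distrib[symmetric] power2_eq_square algebra_simps)
    also have "\<dots> \<le> b\<^sup>2 * ellD b t / (ellD b t * S t)"
    proof (intro divide_right_mono mult_left_mono)
      have "sin t * (1 - sin t) \<le> 1 - sin t" using sin[OF t] mult_right_mono[of "sin t" 1 "1 - sin t"] by simp
      also have "\<dots> \<le> (cos t)\<^sup>2" using sin[OF t] by (simp add: cos_squared_eq)
      also have "\<dots> \<le> ellD b t" by (rule ellD_bounds[OF assms])
      finally show "sin t * (1 - sin t) \<le> ellD b t" .
    qed (use S Dp in \<open>auto simp: less_imp_le\<close>)
    also have "\<dots> = b\<^sup>2 / S t" using Dp[of t] by simp
    also have "\<dots> \<le> b\<^sup>2 / b" using S[of t] assms by (intro divide_left_mono) auto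
    also have "\<dots> = b" using assms by (simp add: power2_eq_square)
    finally show "b\<^sup>2 * sin t / (ellD b t * S t) - b\<^sup>2 * (sin t)\<^sup>2 / (ellD b t * S t) \<le> b" .
  qed
  then show "1 - ellJ b \<le> b * pi / 2" by simp
qed

lemma ellN_one: "ellN 1 = pi / 2"
  by (simp add: ellN_def ellD_def)

lemma ellN_bounds:
  assumes "0 < b" "b \<le> 1"
  shows "pi / 2 \<le> ellN b" "ellN b \<le> pi / (2 * b)"
proof -
  have i: "((\<lambda>t. 1 / sqrt (ellD b t)) has_integral ellN b) {0..pi/2}"
    unfolding ellN_def using ellN_integrand_integrable[OF assms(1)] by (rule integrable_integral)
  have c: "((\<lambda>t. c) has_integral c * (pi/2)) {0..pi/2}" for c :: real
    using has_integral_const_real[of c 0 "pi/2"] by (simp add: mult.commute)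
  have S: "b \<le> sqrt (ellD b t)" "sqrt (ellD b t) \<le> 1" "0 < ellD b t" for t
    using ellD_bounds[OF assms, of t] assms ellD_pos[of b t] by (auto simp: real_le_rsqrt)
  show "pi / 2 \<le> ellN b"
    using has_integral_le[OF c[of 1] i] S by simp
  have "ellN b \<le> 1/b * (pi/2)"
    using S assms by (intro has_integral_le[OF i c[of "1/b"]] divide_left_mono) auto
  then show "ellN b \<le> pi / (2 * b)" by (simp add: field_simps)
qed

lemma ellN_pos: "0 < b \<Longrightarrow> b \<le> 1 \<Longrightarrow> 0 < ellN b"
  using ellN_bounds(1)[of b] pi_half_gt_zero by linarith

text \<open>The derivative (1 - \<open>ellJ b\<close>) / b lies in [0, pi/2] by
  \<open>ellJ_bounds\<close>; both bounds follow by comparison with the value pi/2 at b = 1.\<close>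

lemma ellN_ln_bounds:
  assumes "0 < b" "b \<le> 1"
  shows "0 \<le> ellN b + ln b" "ellN b + ln b \<le> pi / 2"
proof -
  have d: "((\<lambda>b. ellN b + ln b) has_real_derivative (1 - ellJ x) / x) (at x)" if "0 < x" for x
    using DERIV_add[OF ellN_has_real_derivative[OF that] DERIV_ln[OF that]] that by (simp add: field_simps)
  have d2: "((\<lambda>b. pi/2 * b - (ellN b + ln b)) has_real_derivative pi/2 - (1 - ellJ x) / x) (at x)" if "0 < x" for x
    using DERIV_diff[OF DERIV_cmult[OF DERIV_ident, of "pi/2"] d[OF that]] by simp
  have "ellN b + ln b \<le> ellN 1 + ln 1"
  proof (rule DERIV_nonneg_imp_nondecreasing[OF assms(2)])
    fix x assume "b \<le> x" "x \<le> 1"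
    then show "\<exists>y. ((\<lambda>b. ellN b + ln b) has_real_derivative y) (at x) \<and> 0 \<le> y"
      using d[of x] ellJ_bounds[of x] assms by (intro exI[of _ "(1 - ellJ x) / x"]) auto
  qed
  then show "ellN b + ln b \<le> pi / 2" by (simp add: ellN_one)
  have "pi/2 * b - (ellN b + ln b) \<le> pi/2 * 1 - (ellN 1 + ln 1)"
  proof (rule DERIV_nonneg_imp_nondecreasing[OF assms(2)])
    fix x assume "b \<le> x" "x \<le> 1"
    then show "\<exists>y. ((\<lambda>b. pi/2 * b - (ellN b + ln b)) has_real_derivative y) (at x) \<and> 0 \<le> y"
      using d2[of x] ellJ_bounds(3)[of x] assms 
      by (intro exI[of _ "pi/2 - (1 - ellJ x) / x"]) (auto simp: field_simps)
  qed
  moreover have "0 \<le> pi/2 * b" using assms by simp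
  ultimately show "0 \<le> ellN b + ln b" unfolding ellN_one by simp
qed

text \<open>On [b, 1] the slope of \<open>ellN\<close> is at least - 1/b because \<open>ellJ\<close>
  is at most 1. Being linear in 1 - b, the bound gives an error of order k^2 when b = k'.\<close>

lemma ellN_minus_half_pi_le:
  assumes "0 < b" "b \<le> 1"
  shows "ellN b - pi / 2 \<le> (1 - b) / b"
proof -
  have "((\<lambda>x. ellN x + x / b) has_real_derivative - ellJ x / x + 1 / b) (at x)" if "0 < x" for x
    using DERIV_add[OF ellN_has_real_derivative[OF that] DERIV_cdivide[OF DERIV_ident, of b]] by simp
  moreover have "- ellJ x / x + 1 / b \<ge> 0" if "b \<le> x" "x \<le> 1" for x
    using ellJ_bounds[of x] that assms frac_le[of 1 "ellJ x" b x] by simp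
  ultimately have "ellN b + b / b \<le> ellN 1 + 1 / b"
    using assms by (intro DERIV_nonneg_imp_nondecreasing[OF assms(2)]) (metis dual_order.trans less_le_trans)
  then show ?thesis using assms by (simp add: ellN_one field_simps)
qed

text \<open>Landen's substitution \<open>u = t + arctan (b tan t)\<close>, written with an arctangent that is smooth up
  to \<open>t = pi/2\<close>.\<close>

lemma ellN_landen:
  assumes "0 < b"
  shows "ellN b = 2 / (1 + b) * ellN (2 * sqrt b / (1 + b))"
proof -
  \<comment> \<open>One step of the arithmetic-geometric mean from (1, b): \<open>a1\<close> is the
    arithmetic mean, \<open>b1\<close> the geometric mean divided by \<open>a1\<close>.\<close>
  define a1 where "a1 = (1 + b) / 2"
  define b1 where "b1 = 2 * sqrt b / (1 + b)"
  have a1: "0 < a1" and b1: "0 < b1" using assms by (auto simp: a1_def b1_def)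
  \<comment> \<open>The tangent of t - arctan (b tan t) is (1 - b) sin t cos t / \<open>w t\<close>,
    and \<open>w\<close> never vanishes; this yields the form of \<open>u\<close> below.\<close>
  define w where "w = (\<lambda>t. (cos t)\<^sup>2 + b * (sin t)\<^sup>2)"
  define u where "u = (\<lambda>t. 2 * t - arctan ((1 - b) * sin t * cos t / w t))"
  have w: "0 < w t" for t
    using ellD_pos[of "sqrt b" t] assms by (simp add: w_def ellD_def)
  have D: "0 < ellD b t" "0 < ellD b1 t" for t using ellD_pos assms b1 by auto
  define g where "g = (\<lambda>t. 1 / sqrt (ellD b1 t))"
  have gc: "continuous_on A g" for A
    unfolding g_def using D by (intro continuous_intros) (auto simp: less_imp_neq[THEN not_sym])
  have sc: "(sin t)\<^sup>2 = 1 - (cos t)\<^sup>2" for t :: real by (simp add: sin_squared_eq)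
  have key1: "(w t)\<^sup>2 + ((1 - b) * sin t * cos t)\<^sup>2 = ellD b t" for t
    using sin_cos_squared_add[of t] unfolding w_def ellD_def by algebra
  have du: "(u has_real_derivative 1 + b / ellD b t) (at t)" for t
  proof -
    have dw: "(w has_real_derivative - 2 * (1 - b) * sin t * cos t) (at t)"
      unfolding w_def by (auto intro!: derivative_eq_intros simp: algebra_simps)
    define h where "h = (\<lambda>t. (1 - b) * sin t * cos t / w t)"
    define h' where "h' = (((1 - b) * ((cos t)\<^sup>2 - (sin t)\<^sup>2)) * w t
         - ((1 - b) * sin t * cos t) * (- 2 * (1 - b) * sin t * cos t)) / (w t * w t)"
    have dh: "(h has_real_derivative h') (at t)"
      unfolding h_def h'_def using w[of t] 
      by (auto intro!: derivative_eq_intros dw simp: power2_eq_square algebra_simps)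
    have "(u has_real_derivative 2 - h' / (1 + (h t)\<^sup>2)) (at t)"
      using DERIV_diff[OF DERIV_cmult[OF DERIV_ident, of 2] DERIV_chain2[OF DERIV_arctan dh]]
      by (simp add: u_def h_def divide_inverse mult.commute)
    moreover have "2 - h' / (1 + (h t)\<^sup>2) = 1 + b / ellD b t"
    proof -
      have "1 + (h t)\<^sup>2 = ellD b t / (w t)\<^sup>2"
        using w[of t] key1[of t] by (simp add: h_def field_simps)
      then have "h' / (1 + (h t)\<^sup>2) = (((1 - b) * ((cos t)\<^sup>2 - (sin t)\<^sup>2)) * w t
         - ((1 - b) * sin t * cos t) * (- 2 * (1 - b) * sin t * cos t)) / ellD b t"
        using w[of t] D(1)[of t] by (simp add: h'_def power2_eq_square)
      also have "((1 - b) * ((cos t)\<^sup>2 - (sin t)\<^sup>2)) * w t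
         - ((1 - b) * sin t * cos t) * (- 2 * (1 - b) * sin t * cos t)
         = ((1 - b) * ((cos t)\<^sup>2 - (sin t)\<^sup>2)) * w t + 2 * (1 - b)\<^sup>2 * (sin t)\<^sup>2 * (cos t)\<^sup>2"
        by algebra
      also have "\<dots> = ellD b t - b"
        using sin_cos_squared_add[of t] unfolding w_def ellD_def by algebra
      finally show ?thesis using D(1)[of t] by (simp add: diff_divide_distrib)
    qed
    ultimately show ?thesis by simp
  qed
  have cosu: "cos (u t) = ((cos t)\<^sup>2 - b * (sin t)\<^sup>2) / sqrt (ellD b t)" for t
  proof -
    define x where "x = (1 - b) * sin t * cos t / w t"
    have "1 + x\<^sup>2 = ellD b t / (w t)\<^sup>2"
      using w[of t] key1[of t] by (simp add: x_def field_simps)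
    then have "sqrt (1 + x\<^sup>2) = sqrt (ellD b t) / w t"
      using w[of t] by (simp add: real_sqrt_divide)
    then have ca: "cos (arctan x) = w t / sqrt (ellD b t)" 
      and sa: "sin (arctan x) = (1 - b) * sin t * cos t / sqrt (ellD b t)"
      using w[of t] by (simp_all add: cos_arctan sin_arctan x_def)
    have "cos (u t) = (((cos t)\<^sup>2 - (sin t)\<^sup>2) * w t + 2 * sin t * cos t * ((1 - b) * sin t * cos t)) / sqrt (ellD b t)"
      unfolding u_def x_def[symmetric] cos_diff ca sa cos_double sin_double
      by (simp add: add_divide_distrib)
    also have "((cos t)\<^sup>2 - (sin t)\<^sup>2) * w t + 2 * sin t * cos t * ((1 - b) * sin t * cos t)
       = ((cos t)\<^sup>2 - (sin t)\<^sup>2) * w t + 2 * (1 - b) * (sin t)\<^sup>2 * (cos t)\<^sup>2"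
      by algebra
    also have "\<dots> = (cos t)\<^sup>2 - b * (sin t)\<^sup>2"
      using sin_cos_squared_add[of t] unfolding w_def by algebra
    finally show ?thesis .
  qed
  have gu: "(1 + b / ellD b t) * g (u t) = 2 * a1 / sqrt (ellD b t)" for t
  proof -
    have b1sq: "b1\<^sup>2 = 4 * b / (1 + b)\<^sup>2"
      using assms by (simp add: b1_def power_divide power_mult_distrib)
    have "a1\<^sup>2 * ellD b1 (u t) = ((1 + b)\<^sup>2 / 4) * (b1\<^sup>2 + (1 - b1\<^sup>2) * (cos (u t))\<^sup>2)"
      by (simp add: a1_def ellD_def sc power_divide algebra_simps)
    also have "\<dots> = b + (1 - b)\<^sup>2 / 4 * (cos (u t))\<^sup>2"
    proof -
      have "(1 - b)\<^sup>2 = (1 + b)\<^sup>2 - 4 * b" by algebra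
      then have "1 - b1\<^sup>2 = (1 - b)\<^sup>2 / (1 + b)\<^sup>2"
        using assms by (simp add: b1sq diff_divide_distrib)
      then show ?thesis using assms by (simp add: b1sq distrib_left)
    qed
    also have "(cos (u t))\<^sup>2 = ((cos t)\<^sup>2 - b * (sin t)\<^sup>2)\<^sup>2 / ellD b t"
      using D(1)[of t] by (simp add: cosu power_divide)
    also have "b + (1 - b)\<^sup>2 / 4 * (((cos t)\<^sup>2 - b * (sin t)\<^sup>2)\<^sup>2 / ellD b t) =
        (4 * b * ellD b t + (1 - b)\<^sup>2 * ((cos t)\<^sup>2 - b * (sin t)\<^sup>2)\<^sup>2) / (4 * ellD b t)"
      using D(1)[of t] by (simp add: field_simps)
    \<comment> \<open>This perfect square makes \<open>sqrt (ellD b1 (u t))\<close> rational in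
      \<open>sqrt (ellD b t)\<close>, so that its numerator cancels against the derivative of
      \<open>u\<close>.\<close>
    also have "4 * b * ellD b t + (1 - b)\<^sup>2 * ((cos t)\<^sup>2 - b * (sin t)\<^sup>2)\<^sup>2 = (ellD b t + b)\<^sup>2"
      using sin_cos_squared_add[of t] unfolding ellD_def by algebra
    finally have "sqrt (a1\<^sup>2 * ellD b1 (u t)) = sqrt ((ellD b t + b)\<^sup>2 / (4 * ellD b t))" by simp
    then have "a1 * sqrt (ellD b1 (u t)) = (ellD b t + b) / (2 * sqrt (ellD b t))"
      using a1 assms D(1)[of t] by (simp add: real_sqrt_mult real_sqrt_divide)
    then have "sqrt (ellD b1 (u t)) = (ellD b t + b) / (2 * sqrt (ellD b t) * a1)"
      using a1 D(1)[of t] by (simp add: field_simps)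
    then have "g (u t) = 2 * sqrt (ellD b t) * a1 / (ellD b t + b)"
      by (simp add: g_def)
    moreover define S where "S = sqrt (ellD b t)"
    moreover have S: "0 < S" "ellD b t = S * S" using D(1)[of t] by (auto simp: S_def)
    moreover have "(1 + b / (S * S)) * (2 * S * a1 / (S * S + b)) = 2 * a1 / S"
    proof -
      have "1 + b / (S * S) = (S * S + b) / (S * S)" using S(1) by (simp add: field_simps)
      moreover have "0 < S * S + b" using S(1) assms by (simp add: add_pos_pos)
      ultimately show ?thesis using S(1) by simp
    qed
    ultimately show ?thesis by metis
  qed
  have u01: "u 0 = 0" "u (pi / 2) = pi" by (simp_all add: u_def)
  have "((\<lambda>t. (1 + b / ellD b t) *\<^sub>R g (u t)) has_integral integral {u 0..u (pi/2)} g) {0..pi/2}"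
  \<comment> \<open>The arctangent is below pi/2 in absolute value, so \<open>u\<close> stays
    between - pi/2 and 3 pi/2, inside the chosen interval.\<close>
  proof (rule has_integral_substitution[where c = "-pi" and d = "2*pi"])
    show "u ` {0..pi/2} \<subseteq> {-pi..2*pi}"
    proof
      fix y assume "y \<in> u ` {0..pi/2}"
      then obtain t where t: "0 \<le> t" "t \<le> pi/2" "y = u t" by auto
      define z where "z = (1 - b) * sin t * cos t / w t"
      have "y = 2 * t - arctan z" by (simp add: t(3) u_def z_def)
      then show "y \<in> {-pi..2*pi}"
        using t arctan_bounded[of z] by auto
    qed
    show "(u has_real_derivative 1 + b / ellD b t) (at t within {0..pi/2})" for t
      using du by (rule has_field_derivative_at_within)
  qed (auto simp: u01 intro: gc)
  then have "((\<lambda>t. 2 * a1 / sqrt (ellD b t)) has_integral integral {0..pi} g) {0..pi/2}"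
    by (simp add: gu u01)
  moreover have "((\<lambda>t. 2 * a1 * (1 / sqrt (ellD b t))) has_integral 2 * a1 * ellN b) {0..pi/2}"
    unfolding ellN_def by (intro has_integral_mult_right integrable_integral ellN_integrand_integrable assms)
  ultimately have "2 * a1 * ellN b = integral {0..pi} g"
    by (simp add: has_integral_unique)
  also have "\<dots> = integral {0..pi/2} g + integral {pi/2..pi} g"
    by (rule Henstock_Kurzweil_Integration.integral_combine[symmetric])
       (auto intro: integrable_continuous_real gc)
  \<comment> \<open>\<open>u\<close> covers [0, pi], two quarter periods; reflection at pi/2 makes
    them equal and cancels the 2 in \<open>2 * a1\<close>.\<close>
  also have "integral {pi/2..pi} g = integral {0..pi/2} g"
  proof -
    have "((\<lambda>x. (-1) *\<^sub>R g (pi - x)) has_integral (integral {pi - 0..pi - pi/2} g - integral {pi - pi/2..pi - 0} g)) {0..pi/2}"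
      by (rule has_integral_substitution_general[where c = 0 and d = pi and s = "{}"])
         (auto intro!: gc continuous_intros derivative_eq_intros)
    moreover have "g (pi - x) = g x" for x by (simp add: g_def ellD_def cos_diff sin_diff)
    ultimately have "((\<lambda>x. - g x) has_integral - integral {pi/2..pi} g) {0..pi/2}" by simp
    then show ?thesis by (simp add: has_integral_neg_iff has_integral_iff)
  qed
  also have "integral {0..pi/2} g = ellN b1" by (simp add: g_def ellN_def)
  finally show ?thesis using a1 by (simp add: a1_def b1_def field_simps)
qed

section \<open>Moduli and the period ratio under Landen's map\<close>

definition comp_mod :: "real \<Rightarrow> real" where
  "comp_mod k = sqrt (1 - k\<^sup>2)"

definition period_ratio :: "real \<Rightarrow> real" where
  "period_ratio k = ellN k / ellN (comp_mod k)"

definition landen :: "real \<Rightarrow> real" where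
  "landen k = (1 - comp_mod k) / (1 + comp_mod k)"

lemma comp_mod_props:
  assumes "0 < k" "k < 1"
  shows "0 < comp_mod k" "comp_mod k < 1" "(comp_mod k)\<^sup>2 = 1 - k\<^sup>2" "comp_mod (comp_mod k) = k"
proof -
  have k: "k\<^sup>2 < 1" using assms by (simp add: abs_square_less_1)
  then show "0 < comp_mod k" "comp_mod k < 1" "(comp_mod k)\<^sup>2 = 1 - k\<^sup>2"
    using assms by (auto simp: comp_mod_def)
  then show "comp_mod (comp_mod k) = k"
    using assms by (subst comp_mod_def) simp
qed

lemma landen_alt:
  assumes "0 < k" "k < 1"
  shows "landen k = k\<^sup>2 / (1 + comp_mod k)\<^sup>2"
proof -
  have "k\<^sup>2 = (1 - comp_mod k) * (1 + comp_mod k)"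
    using comp_mod_props(3)[OF assms] by (simp add: algebra_simps power2_eq_square)
  then show ?thesis
    using comp_mod_props(1)[OF assms] by (simp add: landen_def power2_eq_square)
qed

lemma landen_props:
  assumes "0 < k" "k < 1"
  shows "0 < landen k" "landen k \<le> k\<^sup>2" "landen k < 1"
    "comp_mod (landen k) = 2 * sqrt (comp_mod k) / (1 + comp_mod k)"
proof -
  note c = comp_mod_props[OF assms]
  show "0 < landen k" "landen k < 1" using c by (auto simp: landen_def)
  have "1 \<le> (1 + comp_mod k)\<^sup>2" using c(1) by (simp add: power2_eq_square algebra_simps)
  then show "landen k \<le> k\<^sup>2"
    unfolding landen_alt[OF assms] using assms by (simp add: divide_le_eq mult_le_cancel_left1)
  have "1 - (landen k)\<^sup>2 = ((1 + comp_mod k)\<^sup>2 - (1 - comp_mod k)\<^sup>2) / (1 + comp_mod k)\<^sup>2"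
    using c(1) by (simp add: landen_def power_divide diff_divide_distrib[of "(1 + comp_mod k)\<^sup>2"])
  also have "(1 + comp_mod k)\<^sup>2 - (1 - comp_mod k)\<^sup>2 = 4 * comp_mod k" by algebra
  finally show "comp_mod (landen k) = 2 * sqrt (comp_mod k) / (1 + comp_mod k)"
    using c(1) by (simp add: comp_mod_def[of "landen k"] real_sqrt_divide real_sqrt_mult)
qed

lemma ellN_comp_mod_landen:
  assumes "0 < k" "k < 1"
  shows "ellN (comp_mod (landen k)) = (1 + comp_mod k) / 2 * ellN (comp_mod k)"
  using ellN_landen[OF comp_mod_props(1)[OF assms]] comp_mod_props(1)[OF assms]
  by (simp add: landen_props(4)[OF assms])

text \<open>Landen's transformation taken at b = \<open>landen k\<close>: the transformed parameter
  2 sqrt b / (1 + b) is then k itself.\<close>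

lemma ellN_of_landen:
  assumes "0 < k" "k < 1"
  shows "ellN (landen k) = (1 + comp_mod k) * ellN k"
proof -
  note c = comp_mod_props(1)[OF assms]
  have 1: "1 + landen k = 2 / (1 + comp_mod k)" using c by (simp add: landen_def field_simps)
  have "sqrt (landen k) = k / (1 + comp_mod k)"
    using c assms by (simp add: landen_alt real_sqrt_divide)
  with c have "2 * sqrt (landen k) / (1 + landen k) = k" unfolding 1 by simp
  then have "ellN (landen k) = 2 / (1 + landen k) * ellN k"
    using ellN_landen[OF landen_props(1)[OF assms]] by simp
  also have "2 / (1 + landen k) = 1 + comp_mod k" unfolding 1 by simp
  finally show ?thesis .
qed

lemma period_ratio_pos: "0 < k \<Longrightarrow> k < 1 \<Longrightarrow> 0 < period_ratio k"
  unfolding period_ratio_def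
  by (intro divide_pos_pos ellN_pos) (auto dest: comp_mod_props intro: less_imp_le)

lemma period_ratio_landen:
  assumes "0 < k" "k < 1"
  shows "period_ratio (landen k) = 2 * period_ratio k"
  using comp_mod_props(1)[OF assms]
  by (simp add: period_ratio_def ellN_of_landen[OF assms] ellN_comp_mod_landen[OF assms])

section \<open>Differentiation of the period ratio and Legendre's relation\<close>

lemma comp_mod_has_real_derivative:
  assumes "0 < k" "k < 1"
  shows "(comp_mod has_real_derivative - k / comp_mod k) (at k)"
proof -
  have "0 < 1 - k\<^sup>2" using comp_mod_props(1)[OF assms] by (simp add: comp_mod_def)
  then show ?thesis
    unfolding comp_mod_def[abs_def] by (auto intro!: derivative_eq_intros simp: field_simps)
qed

text \<open>In classical notation E K' + E' K - K K', since k^2 \<open>ellJ (comp_mod k)\<close> is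
  E - k'^2 K and k'^2 \<open>ellJ k\<close> is E' - k^2 K'.\<close>

definition legendre_form :: "real \<Rightarrow> real" where
  "legendre_form k = (comp_mod k)\<^sup>2 * ellJ k * ellN (comp_mod k) + k\<^sup>2 * ellN k * ellJ (comp_mod k)"

lemma period_ratio_has_real_derivative_aux:
  assumes "0 < k" "k < 1"
  shows "(period_ratio has_real_derivative
            - legendre_form k / (k * (comp_mod k)\<^sup>2 * (ellN (comp_mod k))\<^sup>2)) (at k)"
proof -
  note c = comp_mod_props[OF assms]
  have N: "0 < ellN (comp_mod k)" using c by (intro ellN_pos) auto
  have "((\<lambda>k. ellN (comp_mod k)) has_real_derivative
      - ellJ (comp_mod k) / comp_mod k * (- k / comp_mod k)) (at k)"
    by (rule DERIV_chain2[OF ellN_has_real_derivative[OF c(1)] comp_mod_has_real_derivative[OF assms]])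
  from DERIV_divide[OF ellN_has_real_derivative[OF assms(1)] this]
  show ?thesis
    unfolding period_ratio_def[abs_def]
    by (rule DERIV_cong) (use N c(1) assms in \<open>auto simp: legendre_form_def field_simps power2_eq_square\<close>)
qed

lemma landen_has_real_derivative:
  assumes "0 < k" "k < 1"
  shows "(landen has_real_derivative 2 * k / (comp_mod k * (1 + comp_mod k)\<^sup>2)) (at k)"
proof -
  note c = comp_mod_props[OF assms]
  have "((\<lambda>k. (1 - comp_mod k) / (1 + comp_mod k)) has_real_derivative
     ((0 - (- k / comp_mod k)) * (1 + comp_mod k) - (1 - comp_mod k) * (0 + (- k / comp_mod k))) /
       ((1 + comp_mod k) * (1 + comp_mod k))) (at k)"
    using c(1) by (intro DERIV_divide DERIV_add DERIV_diff DERIV_const comp_mod_has_real_derivative assms) auto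
  then show ?thesis
    unfolding landen_def[abs_def]
    by (rule DERIV_cong) (use c(1) in \<open>auto simp: field_simps power2_eq_square\<close>)
qed

text \<open>The function \<open>period_ratio (landen k)\<close> is differentiated twice over, by the
  chain rule and as \<open>2 * period_ratio k\<close>. Once \<open>ellN\<close> at the complement of
  \<open>landen k\<close> is expressed by \<open>ellN (comp_mod k)\<close>, all factors except the
  two forms cancel.\<close>

lemma legendre_form_landen:
  assumes "0 < k" "k < 1"
  shows "legendre_form (landen k) = legendre_form k"
proof -
  note c = comp_mod_props[OF assms] and L = landen_props[OF assms]
  define x where "x = comp_mod k"
  define n where "n = ellN x"
  have x: "0 < x" using c by (simp add: x_def)
  have n: "0 < n" using c by (auto simp: n_def x_def intro!: ellN_pos)
  have "((\<lambda>k. period_ratio (landen k)) has_real_derivative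
      - legendre_form (landen k) / (landen k * (comp_mod (landen k))\<^sup>2 * (ellN (comp_mod (landen k)))\<^sup>2)
         * (2 * k / (comp_mod k * (1 + comp_mod k)\<^sup>2))) (at k)"
    by (rule DERIV_chain2[OF period_ratio_has_real_derivative_aux[OF L(1,3)] landen_has_real_derivative[OF assms]])
  moreover have "((\<lambda>k. period_ratio (landen k)) has_real_derivative
      2 * (- legendre_form k / (k * (comp_mod k)\<^sup>2 * (ellN (comp_mod k))\<^sup>2))) (at k)"
  \<comment> \<open>The functional equation holds on (0, 1) only, hence the comparison in a
    neighbourhood of k.\<close>
  proof (rule DERIV_cong_ev[THEN iffD1, OF refl _ refl])
    show "((\<lambda>k. 2 * period_ratio k) has_real_derivative
      2 * (- legendre_form k / (k * (comp_mod k)\<^sup>2 * (ellN (comp_mod k))\<^sup>2))) (at k)"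
      by (rule DERIV_cmult[OF period_ratio_has_real_derivative_aux[OF assms]])
    have "\<forall>\<^sub>F x in nhds k. x \<in> {0<..<1}"
      using assms by (intro eventually_nhds_in_open) auto
    then show "\<forall>\<^sub>F x in nhds k. 2 * period_ratio x = period_ratio (landen x)"
      by eventually_elim (simp add: period_ratio_landen)
  qed
  ultimately have "- legendre_form (landen k) / (landen k * (comp_mod (landen k))\<^sup>2 * (ellN (comp_mod (landen k)))\<^sup>2)
         * (2 * k / (comp_mod k * (1 + comp_mod k)\<^sup>2))
     = 2 * (- legendre_form k / (k * (comp_mod k)\<^sup>2 * (ellN (comp_mod k))\<^sup>2))"
    by (rule DERIV_unique)
  moreover have "landen k * (comp_mod (landen k))\<^sup>2 * (ellN (comp_mod (landen k)))\<^sup>2 = k\<^sup>2 * x * n\<^sup>2 / (1 + x)\<^sup>2"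
  proof -
    have N: "ellN (comp_mod (landen k)) = (1 + x) / 2 * n"
      by (simp add: ellN_comp_mod_landen[OF assms] x_def n_def)
    have C: "(comp_mod (landen k))\<^sup>2 = 4 * x / (1 + x)\<^sup>2"
      using x by (simp add: L(4) x_def[symmetric] power_mult_distrib power_divide)
    show ?thesis
      unfolding N C unfolding landen_alt[OF assms] x_def[symmetric]
      using x by (simp add: power2_eq_square)
  qed
  ultimately have "- legendre_form (landen k) / (k\<^sup>2 * x * n\<^sup>2 / (1 + x)\<^sup>2) * (2 * k / (x * (1 + x)\<^sup>2))
      = 2 * (- legendre_form k / (k * x\<^sup>2 * n\<^sup>2))"
    by (simp only: x_def n_def)
  moreover have "- w / (k\<^sup>2 * x * n\<^sup>2 / y) * (2 * k / (x * y)) = 2 * (- w / (k * x\<^sup>2 * n\<^sup>2))"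
    if "0 < y" for w y
    using x n assms that by (simp add: field_simps power2_eq_square)
  moreover have "0 < (1 + x)\<^sup>2" using x by simp
  ultimately show ?thesis using x n assms by simp
qed

text \<open>The first term tends to 1 * 1 * \<open>ellN 1\<close>. In the second the logarithmic
  growth of \<open>ellN\<close> is irrelevant: the bound \<open>ellN k\<close> <= pi / (2 k) already
  loses against k^2.\<close>

lemma legendre_form_tendsto:
  assumes "\<And>n. 0 < f n" "\<And>n. f n < 1" "f \<longlonglongrightarrow> 0"
  shows "(\<lambda>n. legendre_form (f n)) \<longlonglongrightarrow> pi / 2"
proof -
  note c = comp_mod_props[OF assms(1,2)]
  have J: "(\<lambda>n. ellJ (f n)) \<longlonglongrightarrow> 1"
  proof (rule tendsto_sandwich)
    show "\<forall>\<^sub>F n in sequentially. 1 - f n * pi / 2 \<le> ellJ (f n)"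
    proof (intro always_eventually allI)
      fix n show "1 - f n * pi / 2 \<le> ellJ (f n)"
        using ellJ_bounds(3)[OF assms(1) less_imp_le[OF assms(2)], of n] by linarith
    qed
    show "\<forall>\<^sub>F n in sequentially. ellJ (f n) \<le> 1"
      using ellJ_bounds[OF assms(1) less_imp_le[OF assms(2)]] by simp
    have "(\<lambda>n. 1 - f n * pi / 2) \<longlonglongrightarrow> 1 - 0 * pi / 2" by (intro tendsto_intros assms) auto
    then show "(\<lambda>n. 1 - f n * pi / 2) \<longlonglongrightarrow> 1" by simp
  qed simp
  have cm: "(\<lambda>n. comp_mod (f n)) \<longlonglongrightarrow> sqrt (1 - 0\<^sup>2)"
    unfolding comp_mod_def by (intro tendsto_intros assms)
  have "isCont ellN 1" using ellN_has_real_derivative[of 1] by (intro DERIV_isCont) auto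
  then have N: "(\<lambda>n. ellN (comp_mod (f n))) \<longlonglongrightarrow> pi / 2"
    using isCont_tendsto_compose[of 1 ellN "\<lambda>n. comp_mod (f n)"] cm by (simp add: ellN_one)
  have R: "(\<lambda>n. (f n)\<^sup>2 * ellN (f n) * ellJ (comp_mod (f n))) \<longlonglongrightarrow> 0"
  proof (rule tendsto_sandwich)
    show "\<forall>\<^sub>F n in sequentially. 0 \<le> (f n)\<^sup>2 * ellN (f n) * ellJ (comp_mod (f n))"
      using assms c ellN_pos[OF assms(1) less_imp_le[OF assms(2)]] ellJ_bounds(1)[OF c(1) less_imp_le[OF c(2)]]
      by (intro always_eventually allI mult_nonneg_nonneg) (auto simp: less_imp_le)
    have "(f n)\<^sup>2 * ellN (f n) * ellJ (comp_mod (f n)) \<le> f n * pi / 2" for n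
    proof -
      have "(f n)\<^sup>2 * ellN (f n) * ellJ (comp_mod (f n)) \<le> (f n)\<^sup>2 * (pi / (2 * f n)) * 1"
        using assms c ellN_bounds(2)[OF assms(1) less_imp_le[OF assms(2)]]
          ellN_pos[OF assms(1) less_imp_le[OF assms(2)]] ellJ_bounds(1,2)[OF c(1) less_imp_le[OF c(2)]]
        by (intro mult_mono) (auto simp: less_imp_le)
      then show ?thesis using assms(1)[of n] by (simp add: power2_eq_square)
    qed
    then show "\<forall>\<^sub>F n in sequentially. (f n)\<^sup>2 * ellN (f n) * ellJ (comp_mod (f n)) \<le> f n * pi / 2"
      by simp
    have "(\<lambda>n. f n * pi / 2) \<longlonglongrightarrow> 0 * pi / 2" by (intro tendsto_intros assms) auto
    then show "(\<lambda>n. f n * pi / 2) \<longlonglongrightarrow> 0" by simp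
  qed simp
  have "(\<lambda>n. legendre_form (f n)) \<longlonglongrightarrow> (sqrt (1 - 0\<^sup>2))\<^sup>2 * 1 * (pi/2) + 0"
    unfolding legendre_form_def by (intro tendsto_intros J N R cm)
  then show ?thesis by simp
qed

lemma funpow_landen_props:
  assumes "0 < k" "k < 1"
  shows "0 < (landen ^^ n) k" "(landen ^^ n) k \<le> k ^ Suc n" "(landen ^^ n) k < 1"
proof -
  have "0 < (landen ^^ n) k \<and> (landen ^^ n) k \<le> k ^ Suc n"
  proof (induction n)
    case (Suc n)
    define y where "y = (landen ^^ n) k"
    have y: "0 < y" "y \<le> k ^ Suc n" using Suc by (auto simp: y_def)
    have yk: "y \<le> k" using y(2) power_Suc_le_self[of k n] assms by linarith
    then have y1: "y < 1" using assms by simp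
    have "landen y \<le> y * y" using landen_props(2)[OF y(1) y1] by (simp add: power2_eq_square)
    also have "\<dots> \<le> k * k ^ Suc n" using y yk assms by (intro mult_mono) auto
    finally show ?case using landen_props(1)[OF y(1) y1] by (simp add: y_def)
  qed (use assms in auto)
  moreover have "k ^ Suc n < 1" using assms by (intro power_Suc_less_one) auto
  ultimately show "0 < (landen ^^ n) k" "(landen ^^ n) k \<le> k ^ Suc n" "(landen ^^ n) k < 1" by auto
qed

lemma funpow_landen_tendsto:
  assumes "0 < k" "k < 1"
  shows "(\<lambda>n. (landen ^^ n) k) \<longlonglongrightarrow> 0"
proof (rule tendsto_sandwich[where f = "\<lambda>n. 0" and h = "\<lambda>n. k ^ Suc n"])
  show "(\<lambda>n. k ^ Suc n) \<longlonglongrightarrow> 0"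
    using LIMSEQ_power_zero[of k] assms LIMSEQ_Suc by fastforce
qed (use funpow_landen_props[OF assms] in \<open>auto simp: less_imp_le\<close>)

lemma legendre_relation:
  assumes "0 < k" "k < 1"
  shows "legendre_form k = pi / 2"
proof -
  have "legendre_form ((landen ^^ n) k) = legendre_form k" for n
    by (induction n) (use funpow_landen_props[OF assms] in \<open>auto simp: legendre_form_landen\<close>)
  then have "(\<lambda>n. legendre_form k) \<longlonglongrightarrow> pi / 2"
    using legendre_form_tendsto[of "\<lambda>n. (landen ^^ n) k"] funpow_landen_props[OF assms]
      funpow_landen_tendsto[OF assms] by simp
  then show ?thesis by (simp add: LIMSEQ_const_iff)
qed

lemma period_ratio_has_real_derivative:
  assumes "0 < k" "k < 1"
  shows "(period_ratio has_real_derivative - pi / (2 * k * (comp_mod k)\<^sup>2 * (ellN (comp_mod k))\<^sup>2)) (at k)"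
  by (rule DERIV_cong[OF period_ratio_has_real_derivative_aux[OF assms]])
     (simp add: legendre_relation[OF assms])

section \<open>The period ratio as a bijection, and singular moduli\<close>

lemma period_ratio_strict_antimono:
  assumes "0 < a" "a < b" "b < 1"
  shows "period_ratio b < period_ratio a"
proof (rule DERIV_neg_imp_decreasing[OF assms(2)])
  fix x assume x: "a \<le> x" "x \<le> b"
  then have x': "0 < x" "x < 1" using assms by auto
  note c = comp_mod_props[OF x']
  have "0 < ellN (comp_mod x)" using c by (intro ellN_pos) auto
  then have "- pi / (2 * x * (comp_mod x)\<^sup>2 * (ellN (comp_mod x))\<^sup>2) < 0"
    using c(1) x' by (intro divide_neg_pos mult_pos_pos) auto
  then show "\<exists>y. (period_ratio has_real_derivative y) (at x) \<and> y < 0"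
    using period_ratio_has_real_derivative[OF x'] by blast
qed

lemma period_ratio_inj:
  assumes "0 < a" "a < 1" "0 < b" "b < 1" "period_ratio a = period_ratio b"
  shows "a = b"
  using period_ratio_strict_antimono[of a b] period_ratio_strict_antimono[of b a] assms
  by (cases a b rule: linorder_cases) auto

lemma period_ratio_comp_mod:
  assumes "0 < k" "k < 1"
  shows "period_ratio (comp_mod k) = 1 / period_ratio k"
  by (simp add: period_ratio_def comp_mod_props[OF assms])

text \<open>Intermediate values between the fixed point 1 / sqrt 2 of \<open>comp_mod\<close>, where
  the ratio is 1, and a small point \<open>a\<close>. The factor exp (- pi s) in \<open>a\<close>
  forces \<open>ellN a\<close> >= - ln a >= pi s, while \<open>comp_mod a\<close> >= 1/2 keeps the
  denominator at most pi.\<close>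

lemma period_ratio_surj_ge_one:
  assumes "1 \<le> s"
  shows "\<exists>k. 0 < k \<and> k < 1 \<and> period_ratio k = s"
proof -
  define h :: real where "h = 1 / sqrt 2"
  have h: "0 < h" "h < 1" "h\<^sup>2 = 1 / 2" by (auto simp: h_def power_divide)
  have ch: "comp_mod h = h" by (simp add: comp_mod_def h(3)) (simp add: h_def real_sqrt_divide)
  have Nh: "0 < ellN h" using h by (intro ellN_pos) auto
  have Th: "period_ratio h = 1" using Nh by (simp add: period_ratio_def ch)
  define a where "a = min h (exp (- pi * s))"
  have a: "0 < a" "a \<le> h" "a < 1" "ln a \<le> - pi * s"
    using h by (auto simp: a_def simp flip: ln_le_cancel_iff)
       (metis exp_gt_zero ln_exp ln_le_cancel_iff min.cobounded2 min_less_iff_conj h(1))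
  note c = comp_mod_props[OF a(1,3)]
  have "1/2 \<le> comp_mod a"
  proof -
    have "a\<^sup>2 \<le> 1/2" using power_mono[OF a(2), of 2] a(1) h(3) by simp
    then show ?thesis unfolding comp_mod_def by (intro real_le_rsqrt) (simp add: power2_eq_square)
  qed
  then have "pi / (2 * comp_mod a) \<le> pi / 1" using c by (intro divide_left_mono) auto
  then have "ellN (comp_mod a) \<le> pi" using ellN_bounds(2)[OF c(1) less_imp_le[OF c(2)]] by simp
  moreover have "pi * s \<le> ellN a" using ellN_ln_bounds(1)[of a] a by auto
  moreover have "0 < ellN (comp_mod a)" using c by (intro ellN_pos) auto
  ultimately have "s * ellN (comp_mod a) \<le> ellN a"
    using assms by (smt (verit) mult.commute mult_left_mono)
  then have Ta: "s \<le> period_ratio a"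
    using \<open>0 < ellN (comp_mod a)\<close> by (simp add: period_ratio_def le_divide_eq)
  have "\<exists>x\<ge>a. x \<le> h \<and> period_ratio x = s"
  proof (rule IVT2)
    show "\<forall>x. a \<le> x \<and> x \<le> h \<longrightarrow> isCont period_ratio x"
      using period_ratio_has_real_derivative a h by (meson DERIV_isCont le_less_trans less_le_trans)
  qed (use assms Ta Th a in auto)
  then obtain x where "a \<le> x" "x \<le> h" "period_ratio x = s" by auto
  with a h show ?thesis by (intro exI[of _ x]) auto
qed

text \<open>Exchanging k and k' inverts the ratio, which reduces s < 1 to the previous case.\<close>

lemma period_ratio_surj:
  assumes "0 < s"
  shows "\<exists>k. 0 < k \<and> k < 1 \<and> period_ratio k = s"
proof (cases "1 \<le> s")
  case False
  then obtain k where k: "0 < k" "k < 1" "period_ratio k = 1 / s"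
    using period_ratio_surj_ge_one[of "1 / s"] assms by auto
  then show ?thesis
    using comp_mod_props[OF k(1,2)] assms
    by (intro exI[of _ "comp_mod k"]) (simp add: period_ratio_comp_mod)
qed (rule period_ratio_surj_ge_one)

lemma period_ratio_eq_ellK:
  assumes "0 < k" "k < 1"
  shows "ellK (sqrt (1 - k\<^sup>2)) / ellK k = period_ratio k"
  using comp_mod_props[OF assms] assms unfolding period_ratio_def comp_mod_def[symmetric]
  by (simp add: ellK_eq_ellN comp_mod_def[symmetric])

lemma sing_mod_eq:
  assumes "0 < k" "k < 1"
  shows "sing_mod ((period_ratio k)\<^sup>2) = k"
  unfolding sing_mod_def
proof (rule the_equality)
  show "0 < k \<and> k < 1 \<and> ellK (sqrt (1 - k\<^sup>2)) / ellK k = sqrt ((period_ratio k)\<^sup>2)"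
    using assms period_ratio_pos[OF assms] by (simp add: period_ratio_eq_ellK)
  show "y = k" if "0 < y \<and> y < 1 \<and> ellK (sqrt (1 - y\<^sup>2)) / ellK y = sqrt ((period_ratio k)\<^sup>2)" for y
    using that assms period_ratio_pos[OF assms] period_ratio_inj[of y k] period_ratio_eq_ellK[of y]
    by simp
qed

lemma sing_mod_props:
  assumes "0 < r"
  shows "0 < sing_mod r" "sing_mod r < 1" "period_ratio (sing_mod r) = sqrt r"
proof -
  obtain k where k: "0 < k" "k < 1" "period_ratio k = sqrt r"
    using period_ratio_surj[of "sqrt r"] assms by auto
  then have "sing_mod r = k" using sing_mod_eq[OF k(1,2)] assms by simp
  with k show "0 < sing_mod r" "sing_mod r < 1" "period_ratio (sing_mod r) = sqrt r" by auto
qed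

lemma sing_mod_inv_eq:
  assumes "0 < k" "k < 1"
  shows "sing_mod_inv k = (period_ratio k)\<^sup>2"
  unfolding sing_mod_inv_def
proof (rule the_equality)
  show "0 < (period_ratio k)\<^sup>2 \<and> sing_mod ((period_ratio k)\<^sup>2) = k"
    using assms period_ratio_pos[OF assms] by (simp add: sing_mod_eq)
  show "r = (period_ratio k)\<^sup>2" if "0 < r \<and> sing_mod r = k" for r
    using sing_mod_props[of r] that by auto
qed

text \<open>The numerator of the ratio is - ln k up to a bounded error, and the denominator is pi/2
  up to 2 k^2. Replacing the denominator by pi/2 costs at most 4 k, again because
  \<open>ellN k\<close> <= pi / (2 k). This is one of the two comparisons with 2 ln k on which
  rigidity rests.\<close>

lemma period_ratio_ln_bound:
  assumes "0 < k" "k \<le> 1/2"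
  shows "\<bar>pi * period_ratio k + 2 * ln k\<bar> \<le> pi + 4"
proof -
  have k: "0 < k" "k < 1" using assms by auto
  note c = comp_mod_props[OF k]
  define x where "x = comp_mod k"
  have x: "0 < x" "x < 1" "1/2 \<le> x" 
  proof -
    have "k\<^sup>2 \<le> (1/2)\<^sup>2" using assms by (intro power_mono) auto
    then show "1/2 \<le> x" unfolding x_def comp_mod_def by (intro real_le_rsqrt) (simp add: power2_eq_square)
  qed (use c in \<open>auto simp: x_def\<close>)
  have "k\<^sup>2 = (1 - x) * (1 + x)" using c(3) by (simp add: x_def power2_eq_square algebra_simps)
  then have "1 - x \<le> k\<^sup>2" using x mult_left_mono[of 1 "1 + x" "1 - x"] by simp
  then have "(1 - x) / x \<le> k\<^sup>2 / (1/2)" using x by (intro frac_le) auto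
  then have 1: "ellN x - pi/2 \<le> 2 * k\<^sup>2" using ellN_minus_half_pi_le[of x] x by simp
  have 2: "pi/2 \<le> ellN x" using ellN_bounds[of x] x by auto
  have 3: "0 < ellN k" "ellN k \<le> pi / (2 * k)" using ellN_bounds[of k] ellN_pos[of k] k by auto
  have "\<bar>pi * period_ratio k - 2 * ellN k\<bar> = \<bar>ellN k * (pi - 2 * ellN x) / ellN x\<bar>"
  proof -
    have "0 < ellN x" using 2 pi_half_gt_zero by linarith
    then have "pi * period_ratio k - 2 * ellN k = ellN k * (pi - 2 * ellN x) / ellN x"
      by (simp add: period_ratio_def x_def[symmetric] field_simps)
    then show ?thesis by simp
  qed
  also have "\<dots> = ellN k * (2 * ellN x - pi) / ellN x"
  proof -
    have "0 < ellN x" using 2 pi_half_gt_zero by linarith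
    with 2 3 show ?thesis by (simp add: abs_mult)
  qed
  also have "\<dots> \<le> (pi / (2 * k)) * (4 * k\<^sup>2) / (pi/2)"
    using 1 2 3 k by (intro frac_le mult_mono) auto
  also have "\<dots> = 4 * k" using k by (simp add: power2_eq_square)
  also have "\<dots> \<le> 4" using k by simp
  finally have "\<bar>pi * period_ratio k - 2 * ellN k\<bar> \<le> 4" .
  moreover have "0 \<le> ellN k + ln k" "ellN k + ln k \<le> pi / 2" using ellN_ln_bounds[of k] k by auto
  ultimately show ?thesis by linarith
qed

section \<open>Theta series and infinite products\<close>

definition qpoch :: "real \<Rightarrow> nat \<Rightarrow> real" where
  "qpoch Q n = (\<Prod>i<n. 1 - Q ^ Suc i)"

definition euler_phi :: "real \<Rightarrow> real" where
  "euler_phi q = (\<Prod>n. 1 - q ^ Suc n)"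

text \<open>The infinite q-Pochhammer symbol (- s q; q^2), taken below at s = 1 and s = -1.\<close>

definition odd_prod :: "real \<Rightarrow> real \<Rightarrow> real" where
  "odd_prod s q = (\<Prod>n. 1 + s * q ^ (2 * n + 1))"

text \<open>The bilateral series folded at 0: theta_3 for s = 1 and theta_4 for s = -1.\<close>

definition theta :: "real \<Rightarrow> real \<Rightarrow> real" where
  "theta s q = 1 + 2 * (\<Sum>j. s ^ Suc j * q ^ (Suc j)\<^sup>2)"

text \<open>The Gaussian binomial coefficient. The value 0 above the diagonal lets Pascal's rule
  hold at k = M as well.\<close>

definition qbinom :: "real \<Rightarrow> nat \<Rightarrow> nat \<Rightarrow> real" where
  "qbinom Q M k = (if k \<le> M then qpoch Q M / (qpoch Q k * qpoch Q (M - k)) else 0)"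

section \<open>Convergence, sign and elementary identities of the q-products\<close>

lemma qpoch_pos: "0 < Q \<Longrightarrow> Q < 1 \<Longrightarrow> 0 < qpoch Q n"
  unfolding qpoch_def by (intro prod_pos) (auto simp del: power_Suc intro: power_Suc_less_one)

lemma qpoch_le_one: "0 < Q \<Longrightarrow> Q < 1 \<Longrightarrow> qpoch Q n \<le> 1"
  unfolding qpoch_def
  by (intro prod_le_1) (auto simp del: power_Suc simp: less_imp_le power_Suc_less_one)

text \<open>Strict monotonicity gives n <= f n and thus a geometric majorant. A positive first
  exponent keeps every factor away from 0, which the criterion for convergent products
  demands.\<close>

lemma convergent_prod_one_plus_power:
  assumes "0 < q" "q < (1::real)" "\<bar>s\<bar> \<le> 1" "strict_mono f" "f 0 = Suc m"
  shows "convergent_prod (\<lambda>n. 1 + s * q ^ f n)"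
proof (rule summable_imp_convergent_prod_real)
  have le: "\<bar>s * q ^ f n\<bar> \<le> q ^ f n" for n
    using assms by (auto simp: abs_mult intro: mult_left_le_one_le)
  have ge: "n \<le> f n" for n using assms(4) by (rule strict_mono_imp_increasing)
  show "summable (\<lambda>n. \<bar>s * q ^ f n\<bar>)"
  proof (rule summable_comparison_test')
    show "summable (\<lambda>n. q ^ n)" using assms by (intro summable_geometric) auto
    fix n :: nat
    have "\<bar>s * q ^ f n\<bar> \<le> q ^ f n" by (rule le)
    also have "\<dots> \<le> q ^ n" using assms ge by (intro power_decreasing) auto
    finally show "norm \<bar>s * q ^ f n\<bar> \<le> q ^ n" by simp
  qed
  fix n
  have "f 0 \<le> f n" using assms(4) by (simp add: strict_mono_less_eq)
  then obtain j where "f n = Suc j" using assms(5) by (cases "f n") auto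
  then have "q ^ f n < 1" using power_Suc_less_one[of q j] assms by simp
  with le[of n] show "s * q ^ f n \<noteq> - 1" by (auto simp: abs_if split: if_splits)
qed

lemma convergent_prod_euler_phi: "0 < q \<Longrightarrow> q < 1 \<Longrightarrow> convergent_prod (\<lambda>n. 1 - q ^ Suc n :: real)"
  using convergent_prod_one_plus_power[of q "-1" Suc 0] by (simp add: strict_mono_Suc_iff)

lemma convergent_prod_odd_prod:
  "0 < q \<Longrightarrow> q < 1 \<Longrightarrow> \<bar>s\<bar> \<le> 1 \<Longrightarrow> convergent_prod (\<lambda>n. 1 + s * q ^ (2 * n + 1) :: real)"
  using convergent_prod_one_plus_power[of q s "\<lambda>n. 2 * n + 1" 0] by (simp add: strict_mono_Suc_iff)

lemma odd_factor_pos: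
  assumes "0 < q" "q < 1" "\<bar>s\<bar> \<le> (1::real)"
  shows "0 < 1 + s * q ^ (2 * n + 1)"
proof -
  have "\<bar>s * q ^ (2 * n + 1)\<bar> \<le> 1 * q ^ (2 * n + 1)"
    unfolding abs_mult using assms by (intro mult_mono) auto
  also have "\<dots> < 1" using power_Suc_less_one[of q "2 * n"] assms by simp
  finally show ?thesis by (simp add: abs_if split: if_splits)
qed

lemma prodinf_positive:
  fixes f :: "nat \<Rightarrow> real"
  assumes "convergent_prod f" "\<And>n. 0 < f n"
  shows "0 < prodinf f"
proof -
  have "prodinf f \<noteq> 0" using assms prodinf_nonzero[of f] by (metis less_irrefl)
  moreover have "0 \<le> prodinf f"
    using convergent_prod_LIMSEQ[OF assms(1)]
    by (rule LIMSEQ_le_const) (intro exI allI impI prod_nonneg less_imp_le assms(2))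
  ultimately show ?thesis by simp
qed

lemma euler_phi_pos: "0 < q \<Longrightarrow> q < 1 \<Longrightarrow> 0 < euler_phi q"
  unfolding euler_phi_def
  by (intro prodinf_positive convergent_prod_euler_phi) (auto simp del: power_Suc simp: power_Suc_less_one)

lemma odd_prod_pos: "0 < q \<Longrightarrow> q < 1 \<Longrightarrow> \<bar>s\<bar> \<le> 1 \<Longrightarrow> 0 < odd_prod s q"
  unfolding odd_prod_def
  by (intro prodinf_positive convergent_prod_odd_prod odd_factor_pos) auto

lemma LIMSEQ_lessThan_prodinf:
  fixes f :: "nat \<Rightarrow> real"
  assumes "convergent_prod f"
  shows "(\<lambda>n. \<Prod>i<n. f i) \<longlonglongrightarrow> prodinf f"
  using convergent_prod_LIMSEQ[OF assms] by (simp add: LIMSEQ_lessThan_iff_atMost)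

lemma qpoch_tendsto: "0 < q \<Longrightarrow> q < 1 \<Longrightarrow> qpoch q \<longlonglongrightarrow> euler_phi q"
  unfolding qpoch_def euler_phi_def
  by (intro LIMSEQ_lessThan_prodinf convergent_prod_euler_phi)

lemma euler_phi_le_qpoch:
  assumes "0 < q" "q < 1"
  shows "euler_phi q \<le> qpoch q n"
proof (rule decseq_ge[OF _ qpoch_tendsto[OF assms]])
  show "decseq (qpoch q)"
  proof (rule decseq_SucI)
    fix n
    have "qpoch q (Suc n) = qpoch q n * (1 - q ^ Suc n)" by (simp add: qpoch_def)
    also have "\<dots> \<le> qpoch q n * 1" using qpoch_pos[OF assms, of n] assms
      by (intro mult_left_mono) (auto simp: less_imp_le)
    finally show "qpoch q (Suc n) \<le> qpoch q n" by simp
  qed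
qed

lemma euler_phi_le_one: "0 < q \<Longrightarrow> q < 1 \<Longrightarrow> euler_phi q \<le> 1"
  using euler_phi_le_qpoch[of q 0] by (simp add: qpoch_def)

text \<open>The first 2 n factors are sorted by the parity of their exponent.\<close>

lemma euler_phi_split:
  assumes "0 < q" "q < 1"
  shows "euler_phi q = odd_prod (-1) q * euler_phi (q\<^sup>2)"
proof (rule LIMSEQ_unique)
  have q2: "0 < q\<^sup>2" "q\<^sup>2 < 1" using assms by (auto simp: abs_square_less_1)
  have e: "qpoch q (2 * n) = (\<Prod>i<n. 1 + (-1) * q ^ (2 * i + 1)) * qpoch (q\<^sup>2) n" for n
  proof (induction n)
    case (Suc n)
    have "qpoch q (2 * Suc n) = qpoch q (2 * n) * (1 - q ^ (2 * n + 1)) * (1 - q ^ (2 * Suc n))"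
      by (simp add: qpoch_def)
    moreover have "q ^ (2 * Suc n) = (q\<^sup>2) ^ Suc n" by (simp only: power_mult)
    ultimately show ?case unfolding Suc by (auto simp: qpoch_def simp del: power_Suc)
  qed (simp add: qpoch_def)
  show "(\<lambda>n. qpoch q (2 * n)) \<longlonglongrightarrow> euler_phi q"
    using LIMSEQ_subseq_LIMSEQ[OF qpoch_tendsto[OF assms], of "\<lambda>n. 2 * n"]
    by (simp add: o_def strict_mono_Suc_iff)
  show "(\<lambda>n. qpoch q (2 * n)) \<longlonglongrightarrow> odd_prod (-1) q * euler_phi (q\<^sup>2)"
    unfolding e odd_prod_def
    by (intro tendsto_mult qpoch_tendsto q2 LIMSEQ_lessThan_prodinf convergent_prod_odd_prod assms) auto
qed

lemma odd_prod_mult: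
  assumes "0 < q" "q < 1"
  shows "odd_prod 1 q * odd_prod (-1) q = odd_prod (-1) (q\<^sup>2)"
proof -
  have "odd_prod 1 q * odd_prod (-1) q = (\<Prod>n. (1 + 1 * q ^ (2 * n + 1)) * (1 + (-1) * q ^ (2 * n + 1)))"
    unfolding odd_prod_def by (intro prodinf_mult convergent_prod_odd_prod assms) auto
  also have "(\<lambda>n. (1 + 1 * q ^ (2 * n + 1)) * (1 + (-1) * q ^ (2 * n + 1))) = (\<lambda>n. 1 + (-1) * (q\<^sup>2) ^ (2 * n + 1))"
    by (auto simp: algebra_simps power_mult[symmetric] power2_eq_square power_add power_mult_distrib)
  finally show ?thesis by (simp add: odd_prod_def)
qed

lemma odd_prod_minus_bounds:
  assumes "0 < q" "q \<le> p" "p < 1"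
  shows "odd_prod (-1) p \<le> odd_prod (-1) q" "odd_prod (-1) q \<le> 1"
proof -
  have h: "(\<lambda>n. 1 + (-1) * x ^ (2 * n + 1)) has_prod odd_prod (-1) x" if "0 < x" "x < 1" for x :: real
    unfolding odd_prod_def using that by (intro convergent_prod_has_prod convergent_prod_odd_prod) auto
  have nn: "0 \<le> 1 + (-1) * x ^ (2 * n + 1)" if "0 < x" "x < 1" for x :: real and n
    using odd_factor_pos[OF that, of "-1" n] by simp
  have m: "q ^ (2 * n + 1) \<le> p ^ (2 * n + 1)" for n using assms by (intro power_mono) auto
  show "odd_prod (-1) p \<le> odd_prod (-1) q"
    by (rule has_prod_le[OF h h]) (use assms nn[of p] m in auto)
  show "odd_prod (-1) q \<le> 1"
    by (rule has_prod_le[OF h has_prod_one]) (use assms nn[of q] in auto)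
qed

lemma odd_prod_plus_bounds:
  assumes "0 < q" "q \<le> p" "p < 1"
  shows "odd_prod 1 q \<le> odd_prod 1 p" "1 \<le> odd_prod 1 q"
proof -
  have h: "(\<lambda>n. 1 + 1 * x ^ (2 * n + 1)) has_prod odd_prod 1 x" if "0 < x" "x < 1" for x :: real
    unfolding odd_prod_def using that by (intro convergent_prod_has_prod convergent_prod_odd_prod) auto
  have m: "q ^ (2 * n + 1) \<le> p ^ (2 * n + 1)" for n using assms by (intro power_mono) auto
  show "odd_prod 1 q \<le> odd_prod 1 p"
    by (rule has_prod_le[OF h h]) (use assms m in auto)
  show "1 \<le> odd_prod 1 q"
    by (rule has_prod_le[OF has_prod_one h]) (use assms in auto)
qed

section \<open>Gaussian binomials and the finite form of Jacobi's identity\<close>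

lemma qbinom_0: "0 < Q \<Longrightarrow> Q < 1 \<Longrightarrow> qbinom Q M 0 = 1"
  using qpoch_pos[of Q M] by (simp add: qbinom_def) (simp add: qpoch_def)

text \<open>After clearing denominators this is 1 - x y = (1 - y) + y (1 - x) with x = Q^(k+1) and y
  = Q^(M-k).\<close>

lemma qbinom_Suc_Suc:
  assumes "0 < Q" "Q < 1" "k \<le> M"
  shows "qbinom Q (Suc M) (Suc k) = qbinom Q M (Suc k) + Q ^ (M - k) * qbinom Q M k"
proof (cases "k = M")
  case True
  have "0 < qpoch Q n" for n using qpoch_pos assms by simp
  then show ?thesis using True by (simp add: qbinom_def less_imp_neq[THEN not_sym])
next
  case False
  then obtain d where d: "M = k + Suc d" using assms(3) less_imp_Suc_add[of k M] by auto
  have p: "0 < qpoch Q n" for n using qpoch_pos assms by simp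
  have S: "qpoch Q (Suc n) = qpoch Q n * (1 - Q ^ Suc n)" for n by (simp add: qpoch_def)
  have l: "Q ^ Suc n < 1" for n using power_Suc_less_one assms by simp
  define a where "a = qpoch Q k"
  define b where "b = qpoch Q d"
  define c where "c = qpoch Q M"
  define x where "x = Q ^ Suc k"
  define y where "y = Q ^ Suc d"
  have pos: "0 < a" "0 < b" "x < 1" "y < 1" using p l by (auto simp: a_def b_def x_def y_def simp del: power_Suc)
  have m: "M - Suc k = d" "M - k = Suc d" "Suc k \<le> M" "k \<le> M" using d by auto
  have xy: "Q ^ Suc M = x * y" by (simp add: x_def y_def d power_add)
  have 1: "qbinom Q (Suc M) (Suc k) = c * (1 - x * y) / (a * (1 - x) * (b * (1 - y)))"
    unfolding xy[symmetric]
    by (simp add: qbinom_def m S a_def b_def c_def x_def y_def del: power_Suc)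
  have 2: "qbinom Q M (Suc k) = c / (a * (1 - x) * b)"
    by (simp add: qbinom_def m S a_def b_def c_def x_def del: power_Suc)
  have 3: "qbinom Q M k = c / (a * (b * (1 - y)))"
    by (simp add: qbinom_def m S a_def b_def c_def y_def del: power_Suc)
  have 4: "Q ^ (M - k) = y" by (simp add: d y_def)
  show ?thesis 
  proof -
    define u where "u = 1 - x"
    define v where "v = 1 - y"
    have uv: "0 < u" "0 < v" "x = 1 - u" "y = 1 - v" using pos by (auto simp: u_def v_def)
    show ?thesis unfolding 1 2 3 4 uv(3,4) using pos uv(1,2) by (simp add: field_simps)
  qed
qed

text \<open>The q-binomial theorem in base q^2, homogenised by y. The second variable will be
  q^(2N), which keeps all exponents of q natural numbers where the usual derivation of the triple
  product has negative powers.\<close>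

lemma qbinom_theorem:
  assumes "0 < q" "q < 1"
  shows "(\<Prod>j<M. y + x * q ^ (2 * j)) =
         (\<Sum>k\<le>M. qbinom (q\<^sup>2) M k * q ^ (k * (k - 1)) * x ^ k * y ^ (M - k))"
proof (induction M)
  case 0
  then show ?case by (simp add: qbinom_def qpoch_def)
next
  case (Suc M)
  have Q: "0 < q\<^sup>2" "q\<^sup>2 < 1" using assms by (auto simp: abs_square_less_1)
  define f where "f = (\<lambda>k. qbinom (q\<^sup>2) M k * q ^ (k * (k - 1)) * x ^ k)"
  have f0: "f (Suc M) = 0" by (simp add: f_def qbinom_def)
  have "(\<Prod>j<Suc M. y + x * q ^ (2 * j)) = (\<Sum>k\<le>M. f k * y ^ (M - k)) * (y + x * q ^ (2 * M))"
    by (simp add: Suc f_def)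
  also have "\<dots> = (\<Sum>k\<le>M. f k * y ^ (Suc M - k)) + (\<Sum>k\<le>M. f k * y ^ (M - k) * (x * q ^ (2 * M)))"
    unfolding distrib_left sum_distrib_right
    by (intro arg_cong2[of _ _ _ _ "(+)"] sum.cong refl) (simp add: Suc_diff_le)
  also have "(\<Sum>k\<le>M. f k * y ^ (Suc M - k)) = (\<Sum>k\<le>Suc M. f k * y ^ (Suc M - k))"
    by (simp add: f0)
  also have "\<dots> = f 0 * y ^ Suc M + (\<Sum>k\<le>M. f (Suc k) * y ^ (M - k))"
    by (subst sum.atMost_Suc_shift) simp
  also have "f 0 * y ^ Suc M + (\<Sum>k\<le>M. f (Suc k) * y ^ (M - k)) + (\<Sum>k\<le>M. f k * y ^ (M - k) * (x * q ^ (2 * M)))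
     = f 0 * y ^ Suc M + (\<Sum>k\<le>M. (f (Suc k) + f k * x * q ^ (2 * M)) * y ^ (M - k))"
    by (simp add: sum.distrib[symmetric] algebra_simps)
  also have "(\<Sum>k\<le>M. (f (Suc k) + f k * x * q ^ (2 * M)) * y ^ (M - k)) =
      (\<Sum>k\<le>M. qbinom (q\<^sup>2) (Suc M) (Suc k) * q ^ (Suc k * (Suc k - 1)) * x ^ Suc k * y ^ (Suc M - Suc k))"
  proof (intro sum.cong refl)
    fix k assume k: "k \<in> {..M}"
    have "2 * (M - k) + Suc k * k = k * (k - 1) + 2 * M"
      using k by (cases k) (auto simp: algebra_simps)
    then have e: "(q\<^sup>2) ^ (M - k) * q ^ (Suc k * k) = q ^ (k * (k - 1)) * q ^ (2 * M)"
      by (simp add: power_mult[symmetric] power_add[symmetric])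
    have "f k * x * q ^ (2 * M) = qbinom (q\<^sup>2) M k * x ^ Suc k * (q ^ (k * (k - 1)) * q ^ (2 * M))"
      by (simp add: f_def)
    also have "\<dots> = qbinom (q\<^sup>2) M k * x ^ Suc k * ((q\<^sup>2) ^ (M - k) * q ^ (Suc k * k))"
      by (simp only: e)
    finally have "f (Suc k) + f k * x * q ^ (2 * M) =
        (qbinom (q\<^sup>2) M (Suc k) + (q\<^sup>2) ^ (M - k) * qbinom (q\<^sup>2) M k) * q ^ (Suc k * k) * x ^ Suc k"
      by (simp add: f_def algebra_simps)
    then show "(f (Suc k) + f k * x * q ^ (2 * M)) * y ^ (M - k) =
       qbinom (q\<^sup>2) (Suc M) (Suc k) * q ^ (Suc k * (Suc k - 1)) * x ^ Suc k * y ^ (Suc M - Suc k)"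
      using k by (simp add: qbinom_Suc_Suc[OF Q])
  qed
  also have "f 0 * y ^ Suc M + \<dots> = (\<Sum>k\<le>Suc M. qbinom (q\<^sup>2) (Suc M) k * q ^ (k * (k - 1)) * x ^ k * y ^ (Suc M - k))"
    by (simp only: sum.atMost_Suc_shift) (simp add: f_def qbinom_0[OF Q])
  finally show ?case .
qed

text \<open>The q-binomial theorem with M = 2 N, y = q^(2N), x = s q. The upper half of the product
  gives q^(2N) times the factors 1 + s q^(2i+1); the lower half gives the same factors in reverse
  order, up to s and an odd power of q. The total prefactor s^N q^(3 N^2) also divides the sum and
  cancels.\<close>

lemma finite_jacobi:
  fixes s :: real
  assumes "0 < q" "q < 1" "s * s = 1"
  shows "(\<Prod>i<N. 1 + s * q ^ (2 * i + 1))\<^sup>2 =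
         qbinom (q\<^sup>2) (2 * N) N + 2 * (\<Sum>j<N. qbinom (q\<^sup>2) (2 * N) (N + Suc j) * (s ^ Suc j * q ^ (Suc j)\<^sup>2))"
proof -
  define P where "P = (\<Prod>i<N. 1 + s * q ^ (2 * i + 1))"
  define c where "c = (\<lambda>k. qbinom (q\<^sup>2) (2 * N) k)"
  have s0: "s \<noteq> 0" using assms(3) by auto
  have ss: "s ^ (2 * n) = 1" for n using assms(3) by (simp add: power_mult power2_eq_square)
  have "(\<Prod>j<2 * N. q ^ (2 * N) + s * q * q ^ (2 * j)) = s ^ N * q ^ (3 * N\<^sup>2) * P\<^sup>2"
  proof -
    have "(\<Prod>j<2 * N. q ^ (2 * N) + s * q * q ^ (2 * j)) =
       (\<Prod>j<N. q ^ (2 * N) + s * q * q ^ (2 * j)) * (\<Prod>j\<in>{N..<2 * N}. q ^ (2 * N) + s * q * q ^ (2 * j))"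
      by (subst prod.union_disjoint[symmetric]) (auto intro!: prod.cong)
    also have "(\<Prod>j\<in>{N..<2 * N}. q ^ (2 * N) + s * q * q ^ (2 * j)) = (\<Prod>i<N. q ^ (2 * N) * (1 + s * q ^ (2 * i + 1)))"
      by (rule prod.reindex_bij_witness[of _ "\<lambda>i. i + N" "\<lambda>j. j - N"])
         (auto simp: power_add[symmetric] algebra_simps simp flip: power_Suc)
    also have "\<dots> = q ^ (2 * N\<^sup>2) * P"
      by (simp add: prod.distrib P_def power_mult[symmetric] power2_eq_square mult.assoc)
    also have "(\<Prod>j<N. q ^ (2 * N) + s * q * q ^ (2 * j)) = (\<Prod>i<N. s * (1 + s * q ^ (2 * i + 1)) * q ^ (2 * (N - 1 - i) + 1))"
    \<comment> \<open>Reversing the index and using s s = 1 extracts s q^(2j+1) from the factor with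
      index j.\<close>
    proof (rule prod.reindex_bij_witness[of _ "\<lambda>i. N - 1 - i" "\<lambda>i. N - 1 - i"])
      fix j assume "j \<in> {..<N}"
      then have j: "N - 1 - (N - 1 - j) = j" "2 * N = 2 * (N - 1 - j) + 1 + (2 * j + 1)" by auto
      have "s * (1 + s * q ^ (2 * (N - 1 - j) + 1)) * q ^ (2 * j + 1)
         = s * q ^ (2 * j + 1) + (s * s) * (q ^ (2 * (N - 1 - j) + 1) * q ^ (2 * j + 1))"
        by (simp add: algebra_simps)
      also have "q ^ (2 * (N - 1 - j) + 1) * q ^ (2 * j + 1) = q ^ (2 * N)"
        by (subst j(2)) (simp only: power_add)
      finally show "s * (1 + s * q ^ (2 * (N - 1 - j) + 1)) * q ^ (2 * (N - 1 - (N - 1 - j)) + 1)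
         = q ^ (2 * N) + s * q * q ^ (2 * j)"
        unfolding j(1) by (simp add: assms(3))
    qed auto
    also have "\<dots> = s ^ N * P * (\<Prod>i<N. q ^ (2 * (N - 1 - i) + 1))"
      by (simp add: prod.distrib P_def)
    also have "(\<Prod>i<N. q ^ (2 * (N - 1 - i) + 1)) = (\<Prod>i<N. q ^ (2 * i + 1))"
      by (rule prod.reindex_bij_witness[of _ "\<lambda>i. N - 1 - i" "\<lambda>i. N - 1 - i"]) auto
    also have "\<dots> = q ^ N\<^sup>2"
    proof (induction N)
      case (Suc N)
      have "N\<^sup>2 + (2 * N + 1) = (Suc N)\<^sup>2" by (simp add: power2_eq_square)
      then show ?case unfolding prod.lessThan_Suc Suc by (simp only: power_add[symmetric])
    qed simp
    finally show ?thesis by (simp add: power2_eq_square power_add[symmetric] mult_ac)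
  qed
  moreover have "(\<Prod>j<2 * N. q ^ (2 * N) + s * q * q ^ (2 * j)) =
      (\<Sum>k\<le>2 * N. c k * s ^ k * q ^ (k * (k - 1) + k + 2 * N * (2 * N - k)))"
    unfolding qbinom_theorem[OF assms(1,2)] c_def
    by (simp add: power_mult_distrib power_add power_mult mult_ac)
  moreover have "(\<Sum>k\<le>2 * N. c k * s ^ k * q ^ (k * (k - 1) + k + 2 * N * (2 * N - k))) =
     c N * s ^ N * q ^ (3 * N\<^sup>2) + (\<Sum>j<N. 2 * (c (N + Suc j) * s ^ (N + Suc j) * q ^ (3 * N\<^sup>2 + (Suc j)\<^sup>2)))"
  proof -
    \<comment> \<open>Completing the square, the exponent is 3 N^2 + (k - N)^2; hence the terms at N
      + m and N - m agree, and the sum is folded at N.\<close>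
    define g where "g = (\<lambda>k. c k * s ^ k * q ^ (k * (k - 1) + k + 2 * N * (2 * N - k)))"
    have "(\<Sum>k\<le>2 * N. g k) = g N + ((\<Sum>k\<in>{N<..2 * N}. g k) + (\<Sum>k<N. g k))"
    proof -
      have "{..2 * N} = insert N ({N<..2 * N} \<union> {..<N})" by auto
      moreover have "sum g ({N<..2 * N} \<union> {..<N}) = sum g {N<..2 * N} + sum g {..<N}"
        by (intro sum.union_disjoint) auto
      ultimately show ?thesis by simp
    qed
    also have "(\<Sum>k\<in>{N<..2 * N}. g k) = (\<Sum>j<N. g (N + Suc j))"
      by (rule sum.reindex_bij_witness[of _ "\<lambda>j. N + Suc j" "\<lambda>k. k - Suc N"]) auto
    also have "(\<Sum>k<N. g k) = (\<Sum>j<N. g (N - Suc j))"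
      by (rule sum.reindex_bij_witness[of _ "\<lambda>j. N - Suc j" "\<lambda>k. N - Suc k"]) auto
    also have "(\<Sum>j<N. g (N + Suc j)) + (\<Sum>j<N. g (N - Suc j)) = 
        (\<Sum>j<N. 2 * (c (N + Suc j) * s ^ (N + Suc j) * q ^ (3 * N\<^sup>2 + (Suc j)\<^sup>2)))"
    proof (subst sum.distrib[symmetric], intro sum.cong refl)
      fix j assume j: "j \<in> {..<N}"
      define m where "m = N - Suc j"
      have N: "N = m + Suc j" using j by (simp add: m_def)
      have kk: "k * (k - 1) + k = k * k" for k :: nat by (cases k) auto
      have e1: "(N + Suc j) * (N + Suc j - 1) + (N + Suc j) + 2 * N * (2 * N - (N + Suc j)) = 3 * N\<^sup>2 + (Suc j)\<^sup>2"
        unfolding kk unfolding N by (simp add: power2_eq_square algebra_simps)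
      have e2: "m * (m - 1) + m + 2 * N * (2 * N - m) = 3 * N\<^sup>2 + (Suc j)\<^sup>2"
        unfolding kk unfolding N by (simp add: power2_eq_square algebra_simps)
      have "s ^ (N + Suc j) = s ^ m * s ^ (2 * Suc j)"
        unfolding N power_add[symmetric] by (rule arg_cong[of _ _ "\<lambda>n. s ^ n"]) simp
      then have e3: "s ^ m = s ^ (N + Suc j)" unfolding ss by simp
      have "2 * N - (N + Suc j) = m" "2 * N - m = N + Suc j" "m \<le> 2 * N" "N + Suc j \<le> 2 * N"
        using N by auto
      then have e4: "c m = c (N + Suc j)"
        unfolding c_def qbinom_def by (simp only: if_True mult.commute)
      show "g (N + Suc j) + g (N - Suc j) = 2 * (c (N + Suc j) * s ^ (N + Suc j) * q ^ (3 * N\<^sup>2 + (Suc j)\<^sup>2))"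
        unfolding g_def m_def[symmetric] e1 e2 e3 e4 by simp
    qed
    also have "g N = c N * s ^ N * q ^ (3 * N\<^sup>2)"
    proof -
      have "N * (N - 1) + N + 2 * N * (2 * N - N) = 3 * N\<^sup>2"
        by (cases N) (auto simp: power2_eq_square algebra_simps)
      then show ?thesis by (simp only: g_def)
    qed
    finally show ?thesis by (simp add: g_def)
  qed
  ultimately have "s ^ N * q ^ (3 * N\<^sup>2) * P\<^sup>2 =
    s ^ N * q ^ (3 * N\<^sup>2) * (c N + 2 * (\<Sum>j<N. c (N + Suc j) * (s ^ Suc j * q ^ (Suc j)\<^sup>2)))"
    by (simp add: sum_distrib_left distrib_left power_add mult_ac)
  moreover have "s ^ N * q ^ (3 * N\<^sup>2) \<noteq> 0" using s0 assms by simp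
  ultimately show ?thesis unfolding P_def c_def by (simp only: mult_cancel_left) auto
qed

section \<open>Theta series: product formula and doubling formulas\<close>

lemma power_square_le: "0 < q \<Longrightarrow> q < (1::real) \<Longrightarrow> q ^ (Suc j)\<^sup>2 \<le> q ^ Suc j"
  by (intro power_decreasing) (auto simp: power2_eq_square)

lemma summable_theta:
  assumes "0 < q" "q < (1::real)" "\<bar>s\<bar> = 1"
  shows "summable (\<lambda>j. norm (s ^ Suc j * q ^ (Suc j)\<^sup>2))" "summable (\<lambda>j. s ^ Suc j * q ^ (Suc j)\<^sup>2)"
proof -
  show "summable (\<lambda>j. norm (s ^ Suc j * q ^ (Suc j)\<^sup>2))"
  proof (rule summable_comparison_test')
    show "summable (\<lambda>j. q ^ Suc j)" using assms by (subst summable_Suc_iff) (intro summable_geometric, auto)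
    show "norm (norm (s ^ Suc j * q ^ (Suc j)\<^sup>2)) \<le> q ^ Suc j" for j
      using power_square_le[OF assms(1,2), of j] assms by (simp add: abs_mult power_abs del: power_Suc)
  qed
  then show "summable (\<lambda>j. s ^ Suc j * q ^ (Suc j)\<^sup>2)" by (rule summable_norm_cancel)
qed

text \<open>Gauss's proof: let \<open>N\<close> tend to infinity in the finite identity, dominating the Gaussian
  binomials by a constant.\<close>

lemma theta_eq_prod:
  assumes "0 < q" "q < 1" "\<bar>s\<bar> = 1"
  shows "theta s q = euler_phi (q\<^sup>2) * (odd_prod s q)\<^sup>2"
proof -
  have Q: "0 < q\<^sup>2" "q\<^sup>2 < 1" using assms by (auto simp: abs_square_less_1)
  have ss: "s * s = 1" using assms(3) by (auto simp: abs_if split: if_splits)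
  define E where "E = euler_phi (q\<^sup>2)"
  have E: "0 < E" "E \<le> qpoch (q\<^sup>2) n" "qpoch (q\<^sup>2) n \<le> 1" for n
    using euler_phi_pos[OF Q] euler_phi_le_qpoch[OF Q] qpoch_le_one[OF Q] by (auto simp: E_def)
  \<comment> \<open>Numerators are at most 1 and the two denominator factors at least
    \<open>E\<close>, which yields the uniform bound 1 / E^2; the limit is E / (E E).\<close>
  define c where "c = (\<lambda>N k. qbinom (q\<^sup>2) (2 * N) (N + k))"
  have cb: "0 \<le> c N k" "c N k \<le> 1 / (E * E)" for N k
  proof -
    have p: "0 < qpoch (q\<^sup>2) n" for n using E(1) E(2)[of n] by linarith
    show "0 \<le> c N k" using p by (auto simp: c_def qbinom_def less_imp_le)
    show "c N k \<le> 1 / (E * E)"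
      using E p by (auto simp: c_def qbinom_def less_imp_le intro!: frac_le mult_mono)
  qed
  \<comment> \<open>Shifting N by k puts the index inside the range where \<open>qbinom\<close> is
    the quotient; the shift is undone at the end.\<close>
  have cl: "(\<lambda>N. c N k) \<longlonglongrightarrow> 1 / E" for k
  proof -
    have "(\<lambda>N. qpoch (q\<^sup>2) (2 * (N + k)) / (qpoch (q\<^sup>2) (N + k + k) * qpoch (q\<^sup>2) N)) \<longlonglongrightarrow> E / (E * E)"
    proof (intro tendsto_intros)
      have t: "qpoch (q\<^sup>2) \<longlonglongrightarrow> E" unfolding E_def by (rule qpoch_tendsto[OF Q])
      show "qpoch (q\<^sup>2) \<longlonglongrightarrow> E" by (rule t)
      show "(\<lambda>N. qpoch (q\<^sup>2) (2 * (N + k))) \<longlonglongrightarrow> E"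
        by (rule filterlim_compose[OF t]) (auto intro!: filterlim_subseq simp: strict_mono_Suc_iff)
      show "(\<lambda>N. qpoch (q\<^sup>2) (N + k + k)) \<longlonglongrightarrow> E"
        by (rule filterlim_compose[OF t]) (auto intro!: filterlim_subseq simp: strict_mono_Suc_iff)
    qed (use E in auto)
    moreover have "(\<lambda>N. qpoch (q\<^sup>2) (2 * (N + k)) / (qpoch (q\<^sup>2) (N + k + k) * qpoch (q\<^sup>2) N)) = (\<lambda>N. c (N + k) k)"
      by (auto simp: c_def qbinom_def)
    ultimately have "(\<lambda>N. c (N + k) k) \<longlonglongrightarrow> 1 / E" using E by simp
    then show ?thesis by (rule LIMSEQ_offset)
  qed
  \<comment> \<open>Cutting off at j < N turns the finite sums into series over a fixed index set,
    to which dominated convergence applies.\<close>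
  define a where "a = (\<lambda>j N. if j < N then c N (Suc j) * (s ^ Suc j * q ^ (Suc j)\<^sup>2) else 0)"
  have "(\<lambda>N. \<Sum>j. a j N) \<longlonglongrightarrow> (\<Sum>j. 1 / E * (s ^ Suc j * q ^ (Suc j)\<^sup>2))"
  proof -
    have "eventually (\<lambda>n. summable (\<lambda>k. norm (a k n))) sequentially \<and>
           summable (\<lambda>j. norm (1 / E * (s ^ Suc j * q ^ (Suc j)\<^sup>2))) \<and>
           ((\<lambda>n. suminf (\<lambda>k. a k n)) \<longlonglongrightarrow> suminf (\<lambda>j. 1 / E * (s ^ Suc j * q ^ (Suc j)\<^sup>2)))"
    proof (rule tannerys_theorem)
      show "summable (\<lambda>j. 1 / (E * E) * norm (s ^ Suc j * q ^ (Suc j)\<^sup>2))"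
        by (intro summable_mult summable_theta assms)
      show "\<forall>\<^sub>F (j, n) in sequentially \<times>\<^sub>F sequentially. norm (a j n) \<le> 1 / (E * E) * norm (s ^ Suc j * q ^ (Suc j)\<^sup>2)"
      proof (intro always_eventually allI, clarify)
        fix j n
        have "norm (c n (Suc j) * (s ^ Suc j * q ^ (Suc j)\<^sup>2)) \<le> 1 / (E * E) * norm (s ^ Suc j * q ^ (Suc j)\<^sup>2)"
          unfolding norm_mult[of "c n (Suc j)"] using cb[of n "Suc j"] by (intro mult_right_mono) auto
        then show "norm (a j n) \<le> 1 / (E * E) * norm (s ^ Suc j * q ^ (Suc j)\<^sup>2)"
          using E(1) by (auto simp: a_def)
      qed
      fix j
      have "\<forall>\<^sub>F n in sequentially. c n (Suc j) * (s ^ Suc j * q ^ (Suc j)\<^sup>2) = a j n"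
        using eventually_gt_at_top[of j] by eventually_elim (simp add: a_def)
      then show "(\<lambda>n. a j n) \<longlonglongrightarrow> 1 / E * (s ^ Suc j * q ^ (Suc j)\<^sup>2)"
        by (rule Lim_transform_eventually[rotated]) (intro tendsto_mult cl tendsto_const)
    qed simp
    then show ?thesis by blast
  qed
  moreover have "(\<Sum>j. a j N) = (\<Sum>j<N. c N (Suc j) * (s ^ Suc j * q ^ (Suc j)\<^sup>2))" for N
    by (subst suminf_finite[of "{..<N}"]) (auto simp: a_def)
  moreover have "(\<Sum>j. 1 / E * (s ^ Suc j * q ^ (Suc j)\<^sup>2)) = 1 / E * (\<Sum>j. s ^ Suc j * q ^ (Suc j)\<^sup>2)"
    by (intro suminf_mult summable_theta assms)
  ultimately have "(\<lambda>N. c N 0 + 2 * (\<Sum>j<N. c N (Suc j) * (s ^ Suc j * q ^ (Suc j)\<^sup>2))) \<longlonglongrightarrow>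
      1 / E + 2 * (1 / E * (\<Sum>j. s ^ Suc j * q ^ (Suc j)\<^sup>2))"
    by (intro tendsto_intros cl) (simp add: algebra_simps)
  also have "1 / E + 2 * (1 / E * (\<Sum>j. s ^ Suc j * q ^ (Suc j)\<^sup>2)) = theta s q / E"
    by (simp add: theta_def add_divide_distrib)
  also have "(\<lambda>N. c N 0 + 2 * (\<Sum>j<N. c N (Suc j) * (s ^ Suc j * q ^ (Suc j)\<^sup>2)))
     = (\<lambda>N. (\<Prod>i<N. 1 + s * q ^ (2 * i + 1))\<^sup>2)"
    unfolding finite_jacobi[OF assms(1,2) ss] c_def by simp
  finally have "(\<lambda>N. (\<Prod>i<N. 1 + s * q ^ (2 * i + 1))\<^sup>2) \<longlonglongrightarrow> theta s q / E" .
  moreover have "(\<lambda>N. (\<Prod>i<N. 1 + s * q ^ (2 * i + 1))\<^sup>2) \<longlonglongrightarrow> (odd_prod s q)\<^sup>2"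
    unfolding odd_prod_def
    using assms by (intro tendsto_power LIMSEQ_lessThan_prodinf convergent_prod_odd_prod) auto
  ultimately have "theta s q / E = (odd_prod s q)\<^sup>2" by (rule LIMSEQ_unique)
  then show ?thesis using E(1) by (simp add: E_def field_simps)
qed

lemma theta_pos:
  assumes "0 < q" "q < 1" "\<bar>s\<bar> = 1"
  shows "0 < theta s q"
proof -
  have Q: "0 < q\<^sup>2" "q\<^sup>2 < 1" using assms by (auto simp: abs_square_less_1)
  show ?thesis unfolding theta_eq_prod[OF assms] using euler_phi_pos[OF Q] odd_prod_pos[of q s] assms by simp
qed

text \<open>Unordered summation over the integers prepares for reindexing pairs. The power of s is
  written through parity, which makes sense for negative n and is correct because s^2 = 1.\<close>

lemma theta_has_sum_int:
  assumes "0 < q" "q < 1" "\<bar>s\<bar> = 1"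
  shows "((\<lambda>n::int. (if even n then 1 else s) * q ^ nat (n\<^sup>2)) has_sum theta s q) UNIV"
proof -
  define g where "g = (\<lambda>n::int. (if even n then 1 else s) * q ^ nat (n\<^sup>2))"
  define S where "S = (\<Sum>j. s ^ Suc j * q ^ (Suc j)\<^sup>2)"
  have ss: "s * s = 1" using assms(3) by (auto simp: abs_if split: if_splits)
  have sp: "s ^ n = (if even n then 1 else s)" for n by (induction n) (auto simp: ss)
  have 1: "((\<lambda>j. s ^ Suc j * q ^ (Suc j)\<^sup>2) has_sum S) UNIV"
    unfolding S_def by (intro norm_summable_imp_has_sum summable_theta summable_sums assms)
  have g1: "g (int (Suc j)) = s ^ Suc j * q ^ (Suc j)\<^sup>2" "g (- int (Suc j)) = s ^ Suc j * q ^ (Suc j)\<^sup>2" for j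
    unfolding g_def sp by (auto simp: nat_power_eq simp del: of_nat_Suc)
  have "((\<lambda>j. g (int (Suc j))) has_sum S) UNIV" unfolding g1 by (rule 1)
  also have "?this \<longleftrightarrow> (g has_sum S) {1..}"
    by (rule has_sum_reindex_bij_witness[of _ "\<lambda>n. nat (n - 1)" "\<lambda>j. int (Suc j)"]) auto
  finally have 2: "(g has_sum S) {1..}" .
  have "((\<lambda>j. g (- int (Suc j))) has_sum S) UNIV" unfolding g1 by (rule 1)
  also have "?this \<longleftrightarrow> (g has_sum S) {..-1}"
    by (rule has_sum_reindex_bij_witness[of _ "\<lambda>n. nat (- n - 1)" "\<lambda>j. - int (Suc j)"]) auto
  finally have 3: "(g has_sum S) {..-1}" .
  have 4: "(g has_sum 1) {0}" using has_sum_finite[of "{0}" g] by (simp add: g_def)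
  have "(g has_sum (1 + (S + S))) ({0} \<union> ({1..} \<union> {..-1}))"
    by (intro has_sum_Un_disjoint 2 3 4) auto
  moreover have "{0} \<union> ({1..} \<union> {..-1}) = (UNIV :: int set)" by auto
  ultimately show ?thesis by (simp add: theta_def S_def g_def)
qed

lemma theta_sq_has_sum:
  assumes "0 < q" "q < 1" "\<bar>s\<bar> = 1"
  shows "((\<lambda>(m::int, n::int). (if even (m + n) then 1 else s) * q ^ nat (m\<^sup>2 + n\<^sup>2)) has_sum (theta s q)\<^sup>2) UNIV"
proof -
  define g where "g = (\<lambda>s (n::int). (if even n then 1 else s) * q ^ nat (n\<^sup>2))"
  have ss: "s * s = 1" using assms(3) by (auto simp: abs_if split: if_splits)
  have gs: "(g s has_sum theta s q) UNIV" if "\<bar>s\<bar> = 1" for s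
    unfolding g_def by (rule theta_has_sum_int[OF assms(1,2) that])
  \<comment> \<open>For s = 1 the terms are nonnegative, so iterated sums prove joint summability;
    these terms are the norms of those for the given s.\<close>
  have sm: "(\<lambda>(m, n). g 1 m * g 1 n) summable_on (UNIV \<times> UNIV)"
    unfolding split_def
  proof (rule summable_on_SigmaI[where g = "\<lambda>m. g 1 m * theta 1 q"])
    show "((\<lambda>n. g 1 (fst (m, n)) * g 1 (snd (m, n))) has_sum g 1 m * theta 1 q) UNIV" for m
      using has_sum_cmult_right[OF gs[of 1], of "g 1 m"] by simp
    show "(\<lambda>m. g 1 m * theta 1 q) summable_on UNIV"
      using has_sum_cmult_left[OF gs[of 1], of "theta 1 q"] by (auto dest: has_sum_imp_summable)
  qed (use assms in \<open>auto simp: g_def\<close>)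
  have "(\<lambda>x. norm (case x of (m, n) \<Rightarrow> g s m * g s n)) summable_on (UNIV \<times> UNIV)"
  proof (rule summable_on_cong[THEN iffD1, OF _ sm])
    fix x :: "int \<times> int"
    show "(case x of (m, n) \<Rightarrow> g 1 m * g 1 n) = norm (case x of (m, n) \<Rightarrow> g s m * g s n)"
      using assms by (cases x) (auto simp: g_def abs_mult)
  qed
  then have sm': "(\<lambda>(m, n). g s m * g s n) summable_on (UNIV \<times> UNIV)"
    by (rule abs_summable_summable)
  have "((\<lambda>(m, n). g s m * g s n) has_sum theta s q * theta s q) (UNIV \<times> UNIV)"
  proof (rule has_sum_SigmaI[where g = "\<lambda>m. g s m * theta s q", OF _ _ sm'])
    show "((\<lambda>n. case (m, n) of (m, n) \<Rightarrow> g s m * g s n) has_sum g s m * theta s q) UNIV" for m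
      using has_sum_cmult_right[OF gs[OF assms(3)], of "g s m"] by simp
    show "((\<lambda>m. g s m * theta s q) has_sum theta s q * theta s q) UNIV"
      by (rule has_sum_cmult_left[OF gs[OF assms(3)]])
  qed
  moreover have "(\<lambda>(m, n). g s m * g s n) = (\<lambda>(m::int, n::int). (if even (m + n) then 1 else s) * q ^ nat (m\<^sup>2 + n\<^sup>2))"
    by (auto simp: g_def ss fun_eq_iff nat_add_distrib power_add mult_ac)
  ultimately show ?thesis by (simp add: power2_eq_square)
qed

text \<open>The lattice of pairs \<open>(m, n)\<close> with \<open>m + n\<close> even is parametrised by
  \<open>m = a + b\<close>, \<open>n = a - b\<close>, and then \<open>m\<^sup>2 + n\<^sup>2 = 2 a\<^sup>2 + 2 b\<^sup>2\<close>.\<close>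

lemma theta_sq_add:
  assumes "0 < q" "q < 1"
  shows "(theta 1 q)\<^sup>2 + (theta (-1) q)\<^sup>2 = 2 * (theta 1 (q\<^sup>2))\<^sup>2"
proof -
  have Q: "0 < q\<^sup>2" "q\<^sup>2 < 1" using assms by (auto simp: abs_square_less_1)
  define h where "h = (\<lambda>(m::int, n::int). q ^ nat (m\<^sup>2 + n\<^sup>2))"
  define Ev where "Ev = {(m::int, n::int). even (m + n)}"
  have "((\<lambda>x. (case x of (m, n) \<Rightarrow> (if even (m + n) then 1 else 1) * q ^ nat (m\<^sup>2 + n\<^sup>2)) +
         (case x of (m, n) \<Rightarrow> (if even (m + n) then 1 else -1) * q ^ nat (m\<^sup>2 + n\<^sup>2)))
       has_sum ((theta 1 q)\<^sup>2 + (theta (-1) q)\<^sup>2)) (UNIV :: (int \<times> int) set)"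
    by (intro has_sum_add theta_sq_has_sum assms) auto
  \<comment> \<open>Pairs with odd m + n cancel, the others count twice.\<close>
  also have "?this \<longleftrightarrow> ((\<lambda>x. 2 * h x) has_sum ((theta 1 q)\<^sup>2 + (theta (-1) q)\<^sup>2)) Ev"
    by (rule has_sum_cong_neutral) (auto simp: h_def Ev_def split: if_splits)
  also have "\<dots> \<longleftrightarrow> ((\<lambda>(a, b). 2 * (q\<^sup>2) ^ nat (a\<^sup>2 + b\<^sup>2)) has_sum ((theta 1 q)\<^sup>2 + (theta (-1) q)\<^sup>2)) UNIV"
  proof (rule has_sum_reindex_bij_witness[of _ "\<lambda>(a, b). (a + b, a - b)" "\<lambda>(m, n). ((m + n) div 2, (m - n) div 2)"])
    fix x assume "x \<in> Ev"
    then obtain m n where x: "x = (m, n)" "even (m + n)" by (auto simp: Ev_def)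
    define a b where "a = (m + n) div 2" and "b = (m - n) div 2"
    have mn: "m = a + b" "n = a - b" using x(2) unfolding a_def b_def by presburger+
    show "(\<lambda>(a, b). (a + b, a - b)) (case x of (m, n) \<Rightarrow> ((m + n) div 2, (m - n) div 2)) = x"
      unfolding x(1) prod.case a_def[symmetric] b_def[symmetric] using mn by simp
    have "m\<^sup>2 + n\<^sup>2 = 2 * (a\<^sup>2 + b\<^sup>2)" unfolding mn by (simp add: power2_eq_square algebra_simps)
    then have "nat (m\<^sup>2 + n\<^sup>2) = 2 * nat (a\<^sup>2 + b\<^sup>2)" by (simp add: nat_mult_distrib)
    then show "(case case x of (m, n) \<Rightarrow> ((m + n) div 2, (m - n) div 2) of (a, b) \<Rightarrow> 2 * (q\<^sup>2) ^ nat (a\<^sup>2 + b\<^sup>2)) = 2 * h x"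
      unfolding x(1) prod.case a_def[symmetric] b_def[symmetric] h_def by (simp add: power_mult)
  qed (auto simp: Ev_def)
  finally have 1: "((\<lambda>(a, b). 2 * (q\<^sup>2) ^ nat (a\<^sup>2 + b\<^sup>2)) has_sum ((theta 1 q)\<^sup>2 + (theta (-1) q)\<^sup>2)) (UNIV :: (int \<times> int) set)" .
  have "((\<lambda>x. 2 * (case x of (a, b) \<Rightarrow> (if even (a + b) then 1 else 1) * (q\<^sup>2) ^ nat (a\<^sup>2 + b\<^sup>2))) has_sum 2 * (theta 1 (q\<^sup>2))\<^sup>2) (UNIV :: (int \<times> int) set)"
    by (intro has_sum_cmult_right theta_sq_has_sum Q) auto
  then have 2: "((\<lambda>(a, b). 2 * (q\<^sup>2) ^ nat (a\<^sup>2 + b\<^sup>2)) has_sum 2 * (theta 1 (q\<^sup>2))\<^sup>2) (UNIV :: (int \<times> int) set)"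
    by (simp add: split_def)
  from 1 2 show ?thesis by (rule has_sum_unique)
qed

text \<open>Read off from the products: the two odd products multiply to the one at q^2, and
  \<open>euler_phi_split\<close> at q^2 trades the remaining Euler factor for the one at
  q^4.\<close>

lemma theta_mult:
  assumes "0 < q" "q < 1"
  shows "theta 1 q * theta (-1) q = (theta (-1) (q\<^sup>2))\<^sup>2"
proof -
  have Q: "0 < q\<^sup>2" "q\<^sup>2 < 1" using assms by (auto simp: abs_square_less_1)
  have "theta 1 q * theta (-1) q = (euler_phi (q\<^sup>2))\<^sup>2 * (odd_prod 1 q * odd_prod (-1) q)\<^sup>2"
    using assms by (simp add: theta_eq_prod power2_eq_square)
  also have "\<dots> = (euler_phi ((q\<^sup>2)\<^sup>2) * (odd_prod (-1) (q\<^sup>2))\<^sup>2)\<^sup>2"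
    unfolding odd_prod_mult[OF assms] euler_phi_split[OF Q] by (simp add: power2_eq_square)
  also have "\<dots> = (theta (-1) (q\<^sup>2))\<^sup>2"
    using Q by (simp add: theta_eq_prod)
  finally show ?thesis .
qed

text \<open>Comparison with a geometric series, where q / (1 - q) <= 2 q. In the difference all
  terms are nonnegative, and the one with j = 0 alone contributes 4 q.\<close>

lemma theta_bounds:
  assumes "0 < q" "q \<le> 1 / 2"
  shows "1 \<le> theta 1 q" "theta 1 q \<le> 1 + 4 * q" "4 * q \<le> theta 1 q - theta (-1) q"
    "theta 1 q - theta (-1) q \<le> 8 * q"
proof -
  have q: "0 < q" "q < 1" using assms by auto
  define S where "S = (\<lambda>s. \<Sum>j. s ^ Suc j * q ^ (Suc j)\<^sup>2)"
  have sums: "(\<lambda>j. s ^ Suc j * q ^ (Suc j)\<^sup>2) sums S s" if "\<bar>s\<bar> = 1" for s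
    unfolding S_def by (intro summable_sums summable_theta q that)
  have t: "theta s q = 1 + 2 * S s" for s by (simp only: theta_def S_def)
  have geo: "(\<lambda>j. q ^ Suc j) sums (q * (1 / (1 - q)))"
    using sums_mult[OF geometric_sums[of q], of q] q by simp
  have gb: "q * (1 / (1 - q)) \<le> 2 * q"
  proof -
    have "1 / (1 - q) \<le> 1 / (1/2)" using assms by (intro divide_left_mono) auto
    then show ?thesis using mult_left_mono[of "1 / (1 - q)" 2 q] q by simp
  qed
  have S1: "S 1 \<le> q * (1 / (1 - q))"
    using power_square_le[OF q] by (intro sums_le[OF _ sums[of 1] geo]) auto
  show "1 \<le> theta 1 q"
    using sums_le[OF _ sums_zero sums[of 1]] q by (simp add: t)
  show "theta 1 q \<le> 1 + 4 * q" using S1 gb by (simp add: t)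
  have d: "theta 1 q - theta (-1) q = 2 * (S 1 - S (-1))"
    by (simp add: t)
  have ds: "(\<lambda>j. 1 ^ Suc j * q ^ (Suc j)\<^sup>2 - (-1) ^ Suc j * q ^ (Suc j)\<^sup>2) sums (S 1 - S (-1))"
    by (intro sums_diff sums) auto
  have tb: "0 \<le> 1 ^ Suc j * q ^ (Suc j)\<^sup>2 - (-1) ^ Suc j * q ^ (Suc j)\<^sup>2 \<and>
      1 ^ Suc j * q ^ (Suc j)\<^sup>2 - (-1) ^ Suc j * q ^ (Suc j)\<^sup>2 \<le> 2 * q ^ Suc j" for j
    using power_square_le[OF q, of j] q by (cases "even j") (auto simp del: power_Suc simp: uminus_power_if)
  have "S 1 - S (-1) \<le> 2 * (q * (1 / (1 - q)))"
    using tb by (intro sums_le[OF _ ds sums_mult[OF geo]]) auto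
  then show "theta 1 q - theta (-1) q \<le> 8 * q" using gb d by simp
  have "sum (\<lambda>j. 1 ^ Suc j * q ^ (Suc j)\<^sup>2 - (-1) ^ Suc j * q ^ (Suc j)\<^sup>2) {0} \<le> S 1 - S (-1)"
    using tb ds by (intro sum_le_suminf[THEN order_trans]) (auto simp: sums_iff)
  then show "4 * q \<le> theta 1 q - theta (-1) q" using d by simp
qed

section \<open>The nome\<close>

lemma one_less_odd_prod:
  assumes "0 < q" "q < 1"
  shows "1 < odd_prod 1 q"
proof -
  have "(\<lambda>n. if n = 0 then 1 + q ^ (2 * n + 1) else 1) has_prod (1 + q ^ (2 * 0 + 1))"
    by (rule has_prod_single)
  moreover have "(\<lambda>n. 1 + 1 * q ^ (2 * n + 1)) has_prod odd_prod 1 q"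
    unfolding odd_prod_def using assms by (intro convergent_prod_has_prod convergent_prod_odd_prod) auto
  ultimately have "1 + q ^ (2 * 0 + 1) \<le> odd_prod 1 q"
    by (rule has_prod_le) (use assms in auto)
  then show ?thesis using assms by simp
qed

definition theta_comp :: "real \<Rightarrow> real" where
  "theta_comp q = (theta (-1) q / theta 1 q)\<^sup>2"

text \<open>Classically theta_2^2 / theta_3^2; obtained here from its complement, so that k^2 + k'^2
  = 1 is built in.\<close>

definition theta_mod :: "real \<Rightarrow> real" where
  "theta_mod q = comp_mod (theta_comp q)"

lemma square_in_unit: "0 < q \<Longrightarrow> q < 1 \<Longrightarrow> 0 < q\<^sup>2 \<and> q\<^sup>2 < (1::real)"
  by (auto simp: abs_square_less_1)

lemma theta_comp_eq_prod:
  assumes "0 < q" "q < 1"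
  shows "theta_comp q = (odd_prod (-1) q / odd_prod 1 q) ^ 4"
proof -
  have "0 < euler_phi (q\<^sup>2)" using euler_phi_pos square_in_unit[OF assms] by auto
  then show ?thesis
    using assms by (simp add: theta_comp_def theta_eq_prod power_divide power_mult_distrib power_mult[symmetric])
qed

lemma theta_comp_props:
  assumes "0 < q" "q < 1"
  shows "0 < theta_comp q" "theta_comp q < 1" "sqrt (theta_comp q) = theta (-1) q / theta 1 q"
proof -
  have p: "0 < odd_prod (-1) q" "odd_prod (-1) q \<le> 1" "1 < odd_prod 1 q"
    using odd_prod_pos[OF assms, of "-1"] odd_prod_minus_bounds(2)[of q q] one_less_odd_prod[OF assms] assms by auto
  then have "0 < odd_prod (-1) q / odd_prod 1 q" "odd_prod (-1) q / odd_prod 1 q < 1" by auto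
  then show "0 < theta_comp q" "theta_comp q < 1"
    unfolding theta_comp_eq_prod[OF assms]
    using power_Suc_less_one[of "odd_prod (-1) q / odd_prod 1 q" 3] p by (simp_all del: power_Suc)
  show "sqrt (theta_comp q) = theta (-1) q / theta 1 q"
    using theta_pos[OF assms, of 1] theta_pos[OF assms, of "-1"] by (simp add: theta_comp_def)
qed

lemma theta_mod_props:
  assumes "0 < q" "q < 1"
  shows "0 < theta_mod q" "theta_mod q < 1" "comp_mod (theta_mod q) = theta_comp q"
  using comp_mod_props[OF theta_comp_props(1,2)[OF assms]] by (auto simp: theta_mod_def)

text \<open>By \<open>theta_sq_add\<close> and \<open>theta_mult\<close>, replacing q by q^2 sends
  the squares of theta_3 and theta_4 to their arithmetic and geometric means. The quotient k' thus
  becomes 2 sqrt k' / (1 + k'), the complement of Landen's modulus.\<close>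

lemma theta_mod_square:
  assumes "0 < q" "q < 1"
  shows "theta_mod (q\<^sup>2) = landen (theta_mod q)"
proof -
  note Q = square_in_unit[OF assms]
  define a where "a = theta 1 q"
  define b where "b = theta (-1) q"
  have pos: "0 < a" "0 < b" using theta_pos[OF assms] by (auto simp: a_def b_def)
  have "theta_comp (q\<^sup>2) = (theta (-1) (q\<^sup>2))\<^sup>2 / (theta 1 (q\<^sup>2))\<^sup>2"
    by (simp add: theta_comp_def power_divide)
  also have "\<dots> = a * b / ((a\<^sup>2 + b\<^sup>2) / 2)"
    using theta_sq_add[OF assms] theta_mult[OF assms] by (simp add: a_def b_def)
  also have "\<dots> = 2 * (b / a) / (1 + (b / a)\<^sup>2)"
    using pos by (simp add: field_simps power2_eq_square)
  also have "\<dots> = 2 * sqrt (theta_comp q) / (1 + theta_comp q)"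
    unfolding theta_comp_props(3)[OF assms] by (simp add: theta_comp_def a_def b_def)
  also have "\<dots> = comp_mod (landen (theta_mod q))"
    using landen_props(4)[OF theta_mod_props(1,2)[OF assms]] by (simp add: theta_mod_props(3)[OF assms])
  finally show ?thesis
    using comp_mod_props(4)[OF landen_props(1,3)[OF theta_mod_props(1,2)[OF assms]]]
    by (simp add: theta_mod_def)
qed

text \<open>With r = theta_4 / theta_3 one has k^2 = 1 - r^4 = (1 - r)(1 + r)(1 + r^2). Here 1 - r
  lies between q and 8 q and the other factors between 1 and 4, whence 32.\<close>

lemma theta_mod_sq_bounds:
  assumes "0 < q" "q \<le> 1 / 2"
  shows "q \<le> (theta_mod q)\<^sup>2" "(theta_mod q)\<^sup>2 \<le> 32 * q"
proof -
  have q: "0 < q" "q < 1" using assms by auto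
  note B = theta_bounds[OF assms]
  define a where "a = theta 1 q"
  define b where "b = theta (-1) q"
  define r where "r = b / a"
  have ab: "1 \<le> a" "a \<le> 3" "0 < b" "4 * q \<le> a - b" "a - b \<le> 8 * q"
    using B assms theta_pos[OF q, of "-1"] by (auto simp: a_def b_def)
  have r: "0 < r" "r < 1" using ab q by (auto simp: r_def)
  have e: "1 - r = (a - b) / a" using ab by (simp add: r_def diff_divide_distrib)
  have "4 * q / 4 \<le> (a - b) / a" using ab q by (intro frac_le) auto
  then have l: "q \<le> 1 - r" unfolding e by simp
  have "(a - b) / a \<le> 8 * q / 1" using ab q by (intro frac_le) auto
  then have u: "1 - r \<le> 8 * q" unfolding e by simp
  have k: "(theta_mod q)\<^sup>2 = (1 - r) * ((1 + r) * (1 + r\<^sup>2))"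
  proof -
    have "(theta_mod q)\<^sup>2 = 1 - (theta_comp q)\<^sup>2"
      using comp_mod_props(3)[OF theta_comp_props(1,2)[OF q]] by (simp add: theta_mod_def)
    also have "\<dots> = 1 - (r\<^sup>2)\<^sup>2" by (simp add: theta_comp_def r_def a_def b_def)
    finally show ?thesis by (simp add: algebra_simps power2_eq_square)
  qed
  have r2: "r\<^sup>2 \<le> 1" "0 \<le> r\<^sup>2" using r by (auto simp: abs_square_le_1)
  have "1 * 1 \<le> (1 + r) * (1 + r\<^sup>2)" using r r2 by (intro mult_mono) auto
  then have "(1 - r) * 1 \<le> (theta_mod q)\<^sup>2" unfolding k using r by (intro mult_left_mono) auto
  with l show "q \<le> (theta_mod q)\<^sup>2" by simp
  have "(1 + r) * (1 + r\<^sup>2) \<le> 2 * 2" using r r2 by (intro mult_mono) auto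
  then have "(theta_mod q)\<^sup>2 \<le> (1 - r) * 4" unfolding k using r by (intro mult_left_mono) auto
  with u show "(theta_mod q)\<^sup>2 \<le> 32 * q" by simp
qed

lemma theta_mod_ln_bound:
  assumes "0 < q" "q \<le> 1 / 2"
  shows "\<bar>2 * ln (theta_mod q) - ln q\<bar> \<le> ln 32"
proof -
  have q: "0 < q" "q < 1" using assms by auto
  have k: "0 < theta_mod q" using theta_mod_props[OF q] by auto
  have "ln q \<le> ln ((theta_mod q)\<^sup>2)" using theta_mod_sq_bounds[OF assms] q k by simp
  moreover have "ln ((theta_mod q)\<^sup>2) \<le> ln (32 * q)" using theta_mod_sq_bounds[OF assms] q k by simp
  moreover have "ln (32 * q) = ln 32 + ln q" using q by (intro ln_mult_pos) auto
  moreover have "ln ((theta_mod q)\<^sup>2) = 2 * ln (theta_mod q)" using k by (simp add: ln_realpow)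
  moreover have "0 \<le> ln (32::real)" by simp
  ultimately show ?thesis by linarith
qed

section \<open>Rigidity under squaring the nome, and its consequences\<close>

lemma power_two_power_tendsto:
  assumes "0 < q" "q < (1::real)"
  shows "(\<lambda>n. q ^ 2 ^ n) \<longlonglongrightarrow> 0"
proof (rule tendsto_sandwich[OF always_eventually always_eventually tendsto_const])
  show "\<forall>n. q ^ 2 ^ n \<le> q ^ n" using assms by (intro allI power_decreasing) (auto intro: less_imp_le)
  show "(\<lambda>n. q ^ n) \<longlonglongrightarrow> 0" using assms by (intro LIMSEQ_power_zero) auto
qed (use assms in auto)

lemma power_two_power_in_unit: "0 < q \<Longrightarrow> q < 1 \<Longrightarrow> 0 < q ^ 2 ^ n \<and> q ^ 2 ^ n < (1::real)"
  by (simp add: power_less_one_iff)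

text \<open>Iteration gives f (q^(2^n)) = 2^n f q. The left side is eventually bounded by C because
  q^(2^n) tends to 0, so f q is at most C / 2^n in absolute value.\<close>

lemma doubling_eq_zero:
  fixes f :: "real \<Rightarrow> real"
  assumes double: "\<And>q. 0 < q \<Longrightarrow> q < 1 \<Longrightarrow> f (q\<^sup>2) = 2 * f q"
    and bound: "\<And>q. 0 < q \<Longrightarrow> q \<le> d \<Longrightarrow> \<bar>f q\<bar> \<le> C"
    and "0 < d" "0 < q" "q < 1"
  shows "f q = 0"
proof -
  have f: "f (q ^ 2 ^ n) = 2 ^ n * f q" for n
  proof (induction n)
    case (Suc n)
    have "q ^ 2 ^ Suc n = (q ^ 2 ^ n)\<^sup>2" by (simp add: power_mult[symmetric] mult.commute)
    then show ?case using double[of "q ^ 2 ^ n"] power_two_power_in_unit[OF assms(4,5), of n] Suc by simp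
  qed simp
  have "\<forall>\<^sub>F n in sequentially. q ^ 2 ^ n < d"
    using power_two_power_tendsto[OF assms(4,5)] assms(3) by (rule order_tendstoD)
  then have "\<forall>\<^sub>F n in sequentially. \<bar>f q\<bar> \<le> C * (1 / 2) ^ n"
  proof eventually_elim
    case (elim n)
    then have "\<bar>2 ^ n * f q\<bar> \<le> C"
      using bound[of "q ^ 2 ^ n"] power_two_power_in_unit[OF assms(4,5), of n] f[of n] by simp
    then show ?case by (simp add: abs_mult field_simps)
  qed
  moreover have "(\<lambda>n. C * (1 / 2) ^ n) \<longlonglongrightarrow> C * 0"
    by (intro tendsto_intros LIMSEQ_power_zero) auto
  ultimately have "\<bar>f q\<bar> \<le> C * 0"
    by (intro tendsto_le[OF _ _ tendsto_const]) auto
  then show ?thesis by simp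
qed

text \<open>Both summands double, the first by Landen's transformation. Near 0 the term 2 ln k is
  common to \<open>period_ratio_ln_bound\<close> and \<open>theta_mod_ln_bound\<close> and drops out
  of their difference.\<close>

lemma period_ratio_theta_mod:
  assumes "0 < q" "q < 1"
  shows "period_ratio (theta_mod q) = - ln q / pi"
proof -
  have "pi * period_ratio (theta_mod q) + ln q = 0"
  proof (rule doubling_eq_zero[where f = "\<lambda>q. pi * period_ratio (theta_mod q) + ln q"])
    show "pi * period_ratio (theta_mod (q\<^sup>2)) + ln (q\<^sup>2) = 2 * (pi * period_ratio (theta_mod q) + ln q)"
      if "0 < q" "q < 1" for q
      using that period_ratio_landen[OF theta_mod_props(1,2)[OF that]]
      by (simp add: theta_mod_square ln_realpow)
    show "\<bar>pi * period_ratio (theta_mod q) + ln q\<bar> \<le> pi + 4 + ln 32" if q: "0 < q" "q \<le> 1 / 128" for q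
    proof -
      have k: "0 < theta_mod q" using theta_mod_props q by simp
      \<comment> \<open>The radius 1/128 is chosen so that 32 q <= 1/4, hence k <= 1/2.\<close>
      have "(theta_mod q)\<^sup>2 \<le> (1 / 2)\<^sup>2" using theta_mod_sq_bounds(2)[of q] q by (simp add: power_divide)
      then have "theta_mod q \<le> 1 / 2" by (rule power2_le_imp_le) simp
      from period_ratio_ln_bound[OF k this] theta_mod_ln_bound[of q] q show ?thesis by simp
    qed
  qed (use assms in auto)
  then show ?thesis by (simp add: field_simps eq_neg_iff_add_eq_0)
qed

lemma one_plus_theta_comp:
  assumes "0 < q" "q < 1"
  shows "1 + theta_comp q = 2 * (theta 1 (q\<^sup>2))\<^sup>2 / (theta 1 q)\<^sup>2"
  unfolding theta_sq_add[OF assms, symmetric]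
  using theta_pos[OF assms, of 1] by (simp add: theta_comp_def power_divide add_divide_distrib)

lemma ln_theta:
  assumes "0 < q" "q < 1"
  shows "ln (theta 1 q) = ln (euler_phi (q\<^sup>2)) + 2 * ln (odd_prod 1 q)"
  using euler_phi_pos[of "q\<^sup>2"] square_in_unit[OF assms] odd_prod_pos[OF assms, of 1]
  by (simp add: theta_eq_prod assms ln_mult ln_realpow)

text \<open>Rigidity for the logarithm of the quotient of the two sides. The factor 2 in
  \<open>one_plus_theta_comp\<close> makes 4 the one constant compatible with doubling, so
  boundedness near 0 already determines it. Classically the quotient is the fourth power of prod (1
  + q^(2n)) / (1 + q^(2n-1)); the numerator is the reciprocal of
  \<open>odd_prod 1 q * odd_prod (-1) q\<close>.\<close>

lemma theta_mod_eq_prod: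
  assumes "0 < q" "q < 1"
  shows "theta_mod q = 4 * sqrt q / (odd_prod 1 q ^ 8 * odd_prod (-1) q ^ 4)"
proof -
  define f where "f = (\<lambda>q. ln (theta_mod q) - ln 4 - ln q / 2 + 8 * ln (odd_prod 1 q) + 4 * ln (odd_prod (-1) q))"
  have "f q = 0"
  proof (rule doubling_eq_zero[where f = f])
    fix q :: real assume q: "0 < q" "q < 1"
    note Q = square_in_unit[OF q]
    note Q' = conjunct1[OF Q] conjunct2[OF Q]
    have w: "0 < theta_comp q" using theta_comp_props[OF q] by auto
    have k: "0 < theta_mod q" using theta_mod_props[OF q] by auto
    have t: "0 < theta 1 q" "0 < theta 1 (q\<^sup>2)" using theta_pos q Q by auto
    have p: "0 < odd_prod 1 q" "0 < odd_prod (-1) q" using odd_prod_pos q by auto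
    have e: "0 < euler_phi ((q\<^sup>2)\<^sup>2)" "0 < odd_prod (-1) (q\<^sup>2)"
      using euler_phi_pos[of "(q\<^sup>2)\<^sup>2"] square_in_unit[OF Q'] odd_prod_pos[OF Q', of "-1"] by auto
    have 1: "ln (theta_mod (q\<^sup>2)) = 2 * ln (theta_mod q) - 2 * ln (1 + theta_comp q)"
      using theta_mod_props[OF q] w k
      by (simp add: theta_mod_square[OF q] landen_alt ln_div ln_realpow)
    have 2: "ln (1 + theta_comp q) = ln 2 + 2 * ln (theta 1 (q\<^sup>2)) - 2 * ln (theta 1 q)"
      unfolding one_plus_theta_comp[OF q] using t by (simp add: ln_div ln_mult ln_realpow)
    have 3: "ln (odd_prod (-1) (q\<^sup>2)) = ln (odd_prod 1 q) + ln (odd_prod (-1) q)"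
      unfolding odd_prod_mult[OF q, symmetric] using p by (simp add: ln_mult)
    have 4: "ln (euler_phi (q\<^sup>2)) = ln (odd_prod (-1) (q\<^sup>2)) + ln (euler_phi ((q\<^sup>2)\<^sup>2))"
      unfolding euler_phi_split[OF Q'] using e by (simp add: ln_mult)
    have 5: "ln (4::real) = 2 * ln 2" using ln_realpow[of 2 2] by simp
    have 6: "ln (q\<^sup>2) = 2 * ln q" using q by (simp add: ln_realpow)
    show "f (q\<^sup>2) = 2 * f q"
      unfolding f_def using 1 2 3 4 5 6 ln_theta[OF q] ln_theta[OF Q'] by argo
  next
    fix q :: real assume q: "0 < q" "q \<le> 1 / 2"
    have p: "0 < odd_prod 1 q" "0 < odd_prod (-1) q" "0 < odd_prod (-1) (1/2)" using odd_prod_pos q by auto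
    have "0 \<le> ln (odd_prod 1 q)" "ln (odd_prod 1 q) \<le> ln (odd_prod 1 (1/2))"
      using odd_prod_plus_bounds[of q "1/2"] q p by auto
    moreover have "ln (odd_prod (-1) (1/2)) \<le> ln (odd_prod (-1) q)" "ln (odd_prod (-1) q) \<le> 0"
      using odd_prod_minus_bounds[of q "1/2"] q p by auto
    moreover have "\<bar>2 * ln (theta_mod q) - ln q\<bar> \<le> ln 32" by (rule theta_mod_ln_bound[OF q])
    moreover have "0 \<le> ln (4::real)" by simp
    ultimately show "\<bar>f q\<bar> \<le> ln 32 / 2 + ln 4 + 8 * ln (odd_prod 1 (1/2)) - 4 * ln (odd_prod (-1) (1/2))"
      unfolding f_def by linarith
  qed (use assms in auto)
  moreover have p: "0 < odd_prod 1 q" "0 < odd_prod (-1) q" using odd_prod_pos assms by auto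
  have "ln (4 * sqrt q / (odd_prod 1 q ^ 8 * odd_prod (-1) q ^ 4)) =
      ln 4 + ln q / 2 - 8 * ln (odd_prod 1 q) - 4 * ln (odd_prod (-1) q)"
    using assms p by (simp add: ln_div ln_mult ln_realpow ln_sqrt)
  ultimately have "ln (theta_mod q) = ln (4 * sqrt q / (odd_prod 1 q ^ 8 * odd_prod (-1) q ^ 4))"
    by (simp add: f_def)
  then show ?thesis
    using theta_mod_props(1)[OF assms] assms p by (subst (asm) ln_inj_iff) auto
qed

text \<open>The quotient \<open>M\<close> is unchanged by q -> q^2, since Landen's factor (1 + k') /
  2 is exactly the quotient of the squares of theta_3. Along the orbit q^(2^n) both theta values
  tend to 1, so \<open>M\<close> equals \<open>ellN 1\<close>.\<close>

lemma ellN_theta_comp: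
  assumes "0 < q" "q < 1"
  shows "ellN (theta_comp q) = pi / 2 * (theta 1 q)\<^sup>2"
proof -
  define M where "M = (\<lambda>q. ellN (theta_comp q) / (theta 1 q)\<^sup>2)"
  define x where "x = (\<lambda>n. q ^ 2 ^ n)"
  have x: "0 < x n" "x n < 1" for n using power_two_power_in_unit[OF assms] by (auto simp: x_def)
  have x0: "x \<longlonglongrightarrow> 0" unfolding x_def by (rule power_two_power_tendsto[OF assms])
  have M: "M (q\<^sup>2) = M q" if q: "0 < q" "q < 1" for q
  proof -
    have t: "0 < theta 1 q" "0 < theta 1 (q\<^sup>2)" using theta_pos q square_in_unit[OF q] by auto
    have "theta_comp (q\<^sup>2) = comp_mod (landen (theta_mod q))"
      using theta_mod_props(3)[of "q\<^sup>2"] theta_mod_square[OF q] square_in_unit[OF q] by simp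
    then have "ellN (theta_comp (q\<^sup>2)) = (1 + theta_comp q) / 2 * ellN (theta_comp q)"
      using ellN_comp_mod_landen[OF theta_mod_props(1,2)[OF q]] theta_mod_props(3)[OF q] by simp
    then show ?thesis unfolding M_def one_plus_theta_comp[OF q] using t by simp
  qed
  have "M (x n) = M q" for n
  proof (induction n)
    case (Suc n)
    have "x (Suc n) = (x n)\<^sup>2" by (simp add: x_def power_mult[symmetric] mult.commute)
    then show ?case using M[OF x] Suc by simp
  qed (simp add: x_def)
  moreover have "(\<lambda>n. M (x n)) \<longlonglongrightarrow> ellN 1 / 1\<^sup>2"
  proof -
    have small: "\<forall>\<^sub>F n in sequentially. x n < 1 / 2" using x0 by (rule order_tendstoD) simp
    have t: "(\<lambda>n. theta 1 (x n)) \<longlonglongrightarrow> 1"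
    proof (rule tendsto_sandwich[OF _ _ tendsto_const])
      show "\<forall>\<^sub>F n in sequentially. 1 \<le> theta 1 (x n)"
        using small by eventually_elim (use theta_bounds(1) x in auto)
      show "\<forall>\<^sub>F n in sequentially. theta 1 (x n) \<le> 1 + 4 * x n"
        using small by eventually_elim (use theta_bounds(2) x in auto)
      have "(\<lambda>n. 1 + 4 * x n) \<longlonglongrightarrow> 1 + 4 * 0" by (intro tendsto_intros x0)
      then show "(\<lambda>n. 1 + 4 * x n) \<longlonglongrightarrow> 1" by simp
    qed
    have d: "(\<lambda>n. theta 1 (x n) - theta (-1) (x n)) \<longlonglongrightarrow> 0"
    proof (rule tendsto_sandwich)
      show "\<forall>\<^sub>F n in sequentially. 4 * x n \<le> theta 1 (x n) - theta (-1) (x n)"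
        using small by eventually_elim (use theta_bounds(3) x in auto)
      show "\<forall>\<^sub>F n in sequentially. theta 1 (x n) - theta (-1) (x n) \<le> 8 * x n"
        using small by eventually_elim (use theta_bounds(4) x in auto)
    qed (use tendsto_mult_left[OF x0] in \<open>auto intro: tendsto_mult_right_zero x0\<close>)
    have "(\<lambda>n. theta 1 (x n) - (theta 1 (x n) - theta (-1) (x n))) \<longlonglongrightarrow> 1 - 0"
      by (intro tendsto_diff t d)
    then have "(\<lambda>n. theta (-1) (x n)) \<longlonglongrightarrow> 1" by simp
    then have "(\<lambda>n. theta_comp (x n)) \<longlonglongrightarrow> (1 / 1)\<^sup>2"
      unfolding theta_comp_def by (intro tendsto_intros t) auto
    moreover have "isCont ellN 1" using ellN_has_real_derivative[of 1] by (intro DERIV_isCont) auto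
    ultimately have "(\<lambda>n. ellN (theta_comp (x n))) \<longlonglongrightarrow> ellN 1"
      using isCont_tendsto_compose[of 1 ellN "\<lambda>n. theta_comp (x n)"] by simp
    then show ?thesis unfolding M_def by (intro tendsto_intros t) auto
  qed
  ultimately have "M q = pi / 2" by (simp add: LIMSEQ_const_iff ellN_one)
  then show ?thesis using theta_pos[OF assms, of 1] by (simp add: M_def field_simps)
qed

lemma theta_mod_period_ratio:
  assumes "0 < k" "k < 1"
  shows "theta_mod (exp (- pi * period_ratio k)) = k"
proof -
  have q: "0 < exp (- pi * period_ratio k)" "exp (- pi * period_ratio k) < 1"
    using period_ratio_pos[OF assms] by auto
  have "period_ratio (theta_mod (exp (- pi * period_ratio k))) = period_ratio k"
    unfolding period_ratio_theta_mod[OF q] by simp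
  then show ?thesis using period_ratio_inj[OF theta_mod_props(1,2)[OF q] assms] by simp
qed

text \<open>In terms of a, b, E and s = q^(1/6) every quantity is a monomial. On the left E and b
  cancel, and both sides equal a^8 / (2 s^2). The cube root comes from 4^(2/3) = 2 * 2^(1/3), as k
  k' = 4 s^3 / a^12.\<close>

lemma eta_period_ratio_identity:
  assumes k: "0 < k" "k < 1" and q_def: "q = exp (- pi * period_ratio k)"
  shows "pi * (q powr (1/6) * euler_phi q ^ 4) *
           (pi / (2 * k * (comp_mod k)\<^sup>2 * (ellN (comp_mod k))\<^sup>2)) =
         root 3 2 / (k * comp_mod k) powr (2/3)"
proof -
  have q: "0 < q" "q < 1" using period_ratio_pos[OF k] by (auto simp: q_def)
  note Q = square_in_unit[OF q]
  define a where "a = odd_prod 1 q"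
  define b where "b = odd_prod (-1) q"
  define E where "E = euler_phi (q\<^sup>2)"
  have pos: "0 < a" "0 < b" "0 < E" using odd_prod_pos[OF q] euler_phi_pos Q by (auto simp: a_def b_def E_def)
  have kq: "theta_mod q = k" unfolding q_def by (rule theta_mod_period_ratio[OF k])
  have k1: "k = 4 * sqrt q / (a ^ 8 * b ^ 4)" using theta_mod_eq_prod[OF q] by (simp add: kq a_def b_def)
  have c1: "comp_mod k = theta_comp q" using theta_mod_props(3)[OF q] by (simp add: kq)
  have c2: "comp_mod k = (b / a) ^ 4" unfolding c1 theta_comp_eq_prod[OF q] by (simp add: a_def b_def)
  have n1: "ellN (comp_mod k) = pi / 2 * (E * a\<^sup>2)\<^sup>2"
    unfolding c1 ellN_theta_comp[OF q] using q by (simp add: theta_eq_prod E_def a_def)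
  have e1: "euler_phi q = b * E" using euler_phi_split[OF q] by (simp add: b_def E_def)
  define s where "s = q powr (1/6)"
  have s: "0 < s" "sqrt q = s ^ 3"
    using q by (simp_all add: s_def powr_power powr_half_sqrt)
  have kc: "k * comp_mod k = 4 * s ^ 3 / a ^ 12"
    unfolding c2 unfolding k1 s(2) using pos by (simp add: field_simps power_divide)
  have "(k * comp_mod k) powr (2/3) = 4 powr (2/3) * s\<^sup>2 / a ^ 8"
  proof -
    have "(s ^ 3) powr (2/3) = s\<^sup>2" "(a ^ 12) powr (2/3) = a ^ 8"
      using s(1) pos powr_powr[of s 3 "2/3"] powr_powr[of a 12 "2/3"] by simp_all
    then show ?thesis unfolding kc using s(1) pos by (simp add: powr_divide powr_mult)
  qed
  moreover have "(4::real) powr (2/3) = 2 * root 3 2"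
  proof -
    have "(4::real) powr (2/3) = (2 powr 2) powr (2/3)" by simp
    also have "\<dots> = 2 powr (1 + 1/3)" unfolding powr_powr by simp
    also have "\<dots> = 2 * root 3 2" unfolding powr_add by (simp add: root_powr_inverse)
    finally show ?thesis .
  qed
  ultimately have "root 3 2 / (k * comp_mod k) powr (2/3) = a ^ 8 / (2 * s\<^sup>2)"
    using pos s by simp
  moreover have "pi * (s * (b * E) ^ 4) * (pi / (2 * (4 * s ^ 3 / (a ^ 8 * b ^ 4)) * ((b / a) ^ 4)\<^sup>2 *
      (pi / 2 * (E * a\<^sup>2)\<^sup>2)\<^sup>2)) = a ^ 8 / (2 * s\<^sup>2)"
    using pos s(1) by (simp add: power_mult_distrib power_divide power_mult[symmetric]) (simp add: eval_nat_numeral)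
  ultimately show ?thesis
    unfolding n1 unfolding c2 e1 unfolding s_def[symmetric] k1 s(2) by simp
qed

section \<open>The eta integral\<close>

text \<open>Serves the Euler product and the continued fraction alike. Increments of size q^n
  converge uniformly on (0, p) for each p < 1, which suffices because continuity is local.\<close>

lemma telescoping_limit_continuous:
  fixes f :: "nat \<Rightarrow> real \<Rightarrow> real"
  assumes cont: "\<And>n. continuous_on {0<..<1} (f n)"
    and bound: "\<And>n q. 0 < q \<Longrightarrow> q < 1 \<Longrightarrow> \<bar>f (Suc n) q - f n q\<bar> \<le> q ^ n"
  shows "continuous_on {0<..<1} (\<lambda>q. lim (\<lambda>n. f n q))"
    and "\<And>q. 0 < q \<Longrightarrow> q < 1 \<Longrightarrow> convergent (\<lambda>n. f n q)"
proof -
  define l where "l = (\<lambda>q. f 0 q + (\<Sum>i. f (Suc i) q - f i q))"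
  have ul: "uniform_limit {0<..<p} f l sequentially" if p: "0 < p" "p < 1" for p
  proof -
    have "uniform_limit {0<..<p} (\<lambda>n q. \<Sum>i<n. f (Suc i) q - f i q) (\<lambda>q. \<Sum>i. f (Suc i) q - f i q) sequentially"
    proof (rule Weierstrass_m_test)
      show "summable (\<lambda>n. p ^ n)" using p by (intro summable_geometric) auto
      fix n q assume "q \<in> {0<..<p}"
      then have "\<bar>f (Suc n) q - f n q\<bar> \<le> q ^ n" "q ^ n \<le> p ^ n"
        using p by (auto intro!: bound power_mono)
      then show "norm (f (Suc n) q - f n q) \<le> p ^ n" by simp
    qed
    then have "uniform_limit {0<..<p} (\<lambda>n q. f 0 q + (\<Sum>i<n. f (Suc i) q - f i q)) l sequentially"
      unfolding l_def by (intro uniform_limit_add uniform_limit_const)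
    moreover have "f 0 q + (\<Sum>i<n. f (Suc i) q - f i q) = f n q" for n q
      using sum_lessThan_telescope[of "\<lambda>n. f n q" n] by simp
    ultimately show ?thesis by simp
  qed
  have lim: "(\<lambda>n. f n q) \<longlonglongrightarrow> l q" if "0 < q" "q < 1" for q
    by (rule tendsto_uniform_limitI[OF ul[of "(q + 1) / 2"]]) (use that in auto)
  then show "convergent (\<lambda>n. f n q)" if "0 < q" "q < 1" for q
    using that by (auto simp: convergent_def)
  have "isCont l q" if q: "0 < q" "q < 1" for q
  proof -
    define p where "p = (q + 1) / 2"
    have p: "0 < p" "p < 1" "q < p" using q by (auto simp: p_def)
    have "continuous_on {0<..<p} l"
      using p by (intro uniform_limit_theorem[OF _ ul] always_eventually allI continuous_on_subset[OF cont]) auto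
    then show ?thesis using p q by (simp add: continuous_on_eq_continuous_at)
  qed
  then have "continuous_on {0<..<1} l" by (simp add: continuous_on_eq_continuous_at)
  then show "continuous_on {0<..<1} (\<lambda>q. lim (\<lambda>n. f n q))"
    by (rule continuous_on_cong[THEN iffD1, rotated -1]) (auto intro!: limI[symmetric] lim)
qed

lemma continuous_on_euler_phi: "continuous_on {0<..<1} euler_phi"
proof -
  have "continuous_on {0<..<1} (\<lambda>q. lim (\<lambda>n. qpoch q n))"
  proof (rule telescoping_limit_continuous(1)[of "\<lambda>n q. qpoch q n"])
    show "continuous_on {0<..<1} (\<lambda>q. qpoch q n)" for n
      unfolding qpoch_def by (intro continuous_intros)
    show "\<bar>qpoch q (Suc n) - qpoch q n\<bar> \<le> q ^ n" if q: "0 < q" "q < 1" for n q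
    proof -
      have "qpoch q (Suc n) - qpoch q n = - (qpoch q n * q ^ Suc n)"
        by (simp add: qpoch_def algebra_simps)
      then have "\<bar>qpoch q (Suc n) - qpoch q n\<bar> = qpoch q n * q ^ Suc n"
        using qpoch_pos[OF q, of n] q by (simp add: abs_mult)
      also have "\<dots> \<le> 1 * q ^ n"
        using qpoch_pos[OF q, of n] qpoch_le_one[OF q, of n] q
        by (intro mult_mono power_decreasing) auto
      finally show ?thesis by simp
    qed
  qed
  then show ?thesis
    by (rule continuous_on_cong[THEN iffD1, rotated -1]) (auto intro!: limI qpoch_tendsto)
qed

section \<open>The Rogers-Ramanujan continued fraction\<close>

lemma rr_tail_ge_one: "0 \<le> q \<Longrightarrow> 1 \<le> rr_tail q k N"
  by (induction N arbitrary: k) (auto simp: le_add_same_cancel1 intro!: divide_nonneg_pos intro: less_le_trans[OF zero_less_one])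

text \<open>On [1, oo) taking reciprocals does not increase distances, and each level contributes a
  factor q^k <= q. The start k varies in the induction since unfolding one level raises it.\<close>

lemma rr_tail_diff:
  assumes "0 < q" "q < 1" "0 < k"
  shows "\<bar>rr_tail q k (Suc N) - rr_tail q k N\<bar> \<le> q ^ N"
  using assms(3)
proof (induction N arbitrary: k)
  case 0
  then show ?case using assms by (simp add: power_le_one)
next
  case (Suc N)
  define x where "x = rr_tail q (Suc k) (Suc N)"
  define y where "y = rr_tail q (Suc k) N"
  have xy: "1 \<le> x" "1 \<le> y" using rr_tail_ge_one assms by (auto simp: x_def y_def simp del: rr_tail.simps)
  have "rr_tail q k (Suc (Suc N)) - rr_tail q k (Suc N) = q ^ k / x - q ^ k / y"
    by (simp add: x_def y_def)
  also have "\<dots> = q ^ k * (y - x) / (x * y)" using xy by (simp add: field_simps)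
  finally have "\<bar>rr_tail q k (Suc (Suc N)) - rr_tail q k (Suc N)\<bar> = q ^ k * \<bar>x - y\<bar> / (x * y)"
    using xy assms by (simp add: abs_mult abs_minus_commute)
  also have "\<dots> \<le> q ^ 1 * q ^ N / (1 * 1)"
  proof (intro frac_le mult_mono)
    show "\<bar>x - y\<bar> \<le> q ^ N" unfolding x_def y_def by (rule Suc.IH) simp
    show "q ^ k \<le> q ^ 1" using Suc.prems assms by (intro power_decreasing) auto
  qed (use xy assms in auto)
  finally show ?case by simp
qed

lemma continuous_on_rr_tail: "continuous_on {0<..<1} (\<lambda>q. rr_tail q k N)"
proof (induction N arbitrary: k)
  case (Suc N)
  have "rr_tail q (Suc k) N \<noteq> 0" if "0 < q" for q using rr_tail_ge_one[of q "Suc k" N] that by auto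
  then show ?case by (auto intro!: continuous_intros Suc)
qed auto

text \<open>The denominator is at least 1, so the values stay in the compact interval [0, 1], on
  which G is bounded.\<close>

lemma rogers_ramanujan_props:
  shows "continuous_on {0<..<1} rogers_ramanujan"
    and "\<And>q. 0 < q \<Longrightarrow> q < 1 \<Longrightarrow> rogers_ramanujan q \<in> {0..1}"
proof -
  note T = telescoping_limit_continuous[of "\<lambda>N q. rr_tail q 1 N", OF continuous_on_rr_tail rr_tail_diff]
  have ge: "1 \<le> lim (\<lambda>N. rr_tail q 1 N)" if "0 < q" "q < 1" for q
    using T(2)[of q] that rr_tail_ge_one[of q 1]
    by (intro LIMSEQ_le_const[OF convergent_LIMSEQ_iff[THEN iffD1]]) auto
  show "continuous_on {0<..<1} rogers_ramanujan"
    unfolding rogers_ramanujan_def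
  proof (intro continuous_intros)
    show "continuous_on {0<..<1} (\<lambda>q. lim (rr_tail q 1))" using T(1) by simp
  qed (use ge in force)+
  fix q :: real assume q: "0 < q" "q < 1"
  have "q powr (1/5) \<le> 1" using q powr_mono2[of "1/5" q 1] by simp
  then have "q powr (1/5) / lim (\<lambda>N. rr_tail q 1 N) \<le> 1 / 1"
    using ge[OF q] by (intro frac_le) auto
  then show "rogers_ramanujan q \<in> {0..1}"
    using ge[OF q] by (simp add: rogers_ramanujan_def)
qed

section \<open>Eta on the imaginary axis and the derivative of the tail integral\<close>

lemma prodinf_complex_of_real:
  assumes "convergent_prod f"
  shows "(\<Prod>n. complex_of_real (f n)) = complex_of_real (\<Prod>n. f n)"
proof -
  have "(\<lambda>n. \<Prod>i\<le>n. complex_of_real (f i)) \<longlonglongrightarrow> complex_of_real (\<Prod>n. f n)"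
    unfolding of_real_prod[symmetric] by (intro tendsto_of_real convergent_prod_LIMSEQ assms)
  moreover have "convergent_prod (\<lambda>n. complex_of_real (f n))"
    using assms convergent_prod_of_real_iff[of f] by (simp add: o_def)
  ultimately show ?thesis using convergent_prod_LIMSEQ LIMSEQ_unique by blast
qed

text \<open>At i t / 2 the factors are 1 - q^n with q = exp (- pi t), and the fourth power turns the
  prefactor q^(1/24) into q^(1/6).\<close>

lemma dedekind_eta_imaginary:
  assumes "0 < t"
  shows "dedekind_eta (\<i> * of_real t / 2) ^ 4 =
         of_real (exp (- pi * t) powr (1/6) * euler_phi (exp (- pi * t)) ^ 4)"
proof -
  define q where "q = exp (- pi * t)"
  have q: "0 < q" "q < 1" using assms by (auto simp: q_def)
  have "exp (2 * pi * \<i> * of_nat (Suc n) * (\<i> * of_real t / 2)) = complex_of_real (q ^ Suc n)" for n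
  proof -
    have "2 * pi * \<i> * of_nat (Suc n) * (\<i> * of_real t / 2) = complex_of_real (real (Suc n) * (- pi * t))"
      by (simp add: algebra_simps complex_eq_iff)
    then show ?thesis by (simp only: exp_of_real q_def exp_of_nat_mult)
  qed
  then have "(\<Prod>n. 1 - exp (2 * pi * \<i> * of_nat (Suc n) * (\<i> * of_real t / 2))) =
      (\<Prod>n. complex_of_real (1 - q ^ Suc n))"
    by (simp del: power_Suc of_nat_Suc)
  also have "\<dots> = complex_of_real (euler_phi q)"
    unfolding euler_phi_def by (intro prodinf_complex_of_real convergent_prod_euler_phi q)
  finally have 1: "(\<Prod>n. 1 - exp (2 * pi * \<i> * of_nat (Suc n) * (\<i> * of_real t / 2))) = complex_of_real (euler_phi q)" .
  have "pi * \<i> * (\<i> * of_real t / 2) / 12 = complex_of_real (- pi * t / 24)"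
    by (simp add: complex_eq_iff)
  then have 2: "exp (pi * \<i> * (\<i> * of_real t / 2) / 12) = complex_of_real (exp (- pi * t / 24))"
    by (simp only: exp_of_real)
  have 3: "exp (- pi * t / 24) ^ 4 = q powr (1/6)"
    by (simp add: q_def powr_def exp_of_nat_mult[symmetric])
  show ?thesis
    unfolding dedekind_eta_def 1 2 q_def[symmetric] 3[symmetric] by (simp add: power_mult_distrib)
qed

text \<open>Cutting the ray at a fixed point beyond x leaves a compact interval for the fundamental
  theorem and a constant remainder.\<close>

lemma integral_tail_has_real_derivative:
  fixes h :: "real \<Rightarrow> real"
  assumes cont: "continuous_on {0<..} h" and int: "\<And>c. 0 < c \<Longrightarrow> h integrable_on {c..}" and "0 < x"
  shows "((\<lambda>x. integral {x..} h) has_real_derivative - h x) (at x)"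
proof -
  define a where "a = x / 2"
  define b where "b = 2 * x"
  have ab: "0 < a" "a < x" "x < b" using assms(3) by (auto simp: a_def b_def)
  have "((\<lambda>y. integral {y..b} h) has_real_derivative - h x) (at x within {a..b})"
    using ab by (intro integral_has_real_derivative' continuous_on_subset[OF cont]) auto
  moreover have "at x within {a..b} = at x" using ab by (intro at_within_Icc_at) auto
  ultimately have "((\<lambda>y. integral {y..b} h + integral {b..} h) has_real_derivative - h x + 0) (at x)"
    by (intro DERIV_add DERIV_const) simp
  moreover have "integral {y..b} h + integral {b..} h = integral {y..} h" if "y \<in> {a<..<b}" for y
  proof -
    have "{y..b} \<inter> {b..} = {b}" "{y..b} \<union> {b..} = {y..}" using that by auto
    moreover have "h integrable_on {y..b}"
      using that ab by (intro integrable_continuous_real continuous_on_subset[OF cont]) auto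
    ultimately show ?thesis
      using integral_Un[of h "{y..b}" "{b..}"] int[of b] ab by simp
  qed
  ultimately show ?thesis
    using ab has_field_derivative_transform_within_open[of _ "- h x" x "{a<..<b}" "\<lambda>y. integral {y..} h"] by auto
qed

text \<open>With k = \<open>sing_mod (mG A)\<close> the implicit equation reads A =
  \<open>FG G (sing_mod_inv k)\<close>, so this composite is A as a function of k. It is complex
  valued because eta is, hence the vector derivative.\<close>

theorem theorem2:
  fixes G mG :: "real \<Rightarrow> real" and X :: "real set" and A :: real
  assumes "smooth_fun G"
    and "\<forall>x\<in>X. 0 < mG x \<and> complex_of_real x = FG G (mG x)"
    and "A \<in> X"
  shows "((\<lambda>k. FG G (sing_mod_inv k)) has_vector_derivative
           complex_of_real (root 3 2 * G (rogers_ramanujan (exp (- pi * sqrt (mG A))))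
              / (sing_mod (mG A) * sqrt (1 - (sing_mod (mG A))\<^sup>2)) powr (2/3)))
         (at (sing_mod (mG A)))"
proof -
  define k where "k = sing_mod (mG A)"
  define g where "g = (\<lambda>t. G (rogers_ramanujan (exp (- pi * t))))"
  define e where "e = (\<lambda>t. exp (- pi * t) powr (1/6) * euler_phi (exp (- pi * t)) ^ 4)"
  define h where "h = (\<lambda>t. e t * g t)"
  have "0 < mG A" using assms(2,3) by auto
  note k = sing_mod_props[OF this, folded k_def]
  have Gc: "continuous_on S G" for S
  proof -
    have "((deriv ^^ 0) G) differentiable (at x)" for x using assms(1) unfolding smooth_fun_def by blast
    then show ?thesis
      by (intro differentiable_imp_continuous_on differentiable_at_imp_differentiable_on) auto
  qed
  have "compact (G ` {0..1})" by (intro compact_continuous_image Gc) auto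
  then have "bounded (G ` {0..1})" by (rule compact_imp_bounded)
  then obtain M where "\<forall>y\<in>{0..1}. \<bar>G y\<bar> \<le> M" by (auto simp: bounded_iff)
  then have M: "\<bar>G y\<bar> \<le> M" if "y \<in> {0..1}" for y using that by blast
  have qt: "exp (- pi * t) \<in> {0<..<1}" if "0 < t" for t using that by simp
  have hc: "continuous_on {0<..} h"
    unfolding h_def e_def g_def using qt
    by (intro continuous_intros continuous_on_compose2[OF continuous_on_euler_phi]
        continuous_on_compose2[OF rogers_ramanujan_props(1)] continuous_on_compose2[OF Gc[of UNIV]]) auto
  \<comment> \<open>The decay comes from q^(1/6) alone; the Euler product is at most 1 and G is at
    most \<open>M\<close>.\<close>
  have hb: "\<bar>h t\<bar> \<le> M * exp (- (pi / 6) * t)" if "0 < t" for t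
  proof -
    have q: "0 < exp (- pi * t)" "exp (- pi * t) < 1" using qt[OF that] by auto
    have "exp (- pi * t) powr (1/6) = exp (- (pi / 6) * t)" by (simp add: powr_def)
    moreover have "0 \<le> euler_phi (exp (- pi * t)) ^ 4" "euler_phi (exp (- pi * t)) ^ 4 \<le> 1"
      using euler_phi_pos[OF q] euler_phi_le_one[OF q] by (auto intro: power_le_one)
    ultimately have "\<bar>e t\<bar> \<le> exp (- (pi / 6) * t) * 1"
      unfolding e_def abs_mult by (intro mult_mono) auto
    moreover have "\<bar>g t\<bar> \<le> M"
      unfolding g_def by (intro M rogers_ramanujan_props(2) q)
    ultimately have "\<bar>e t\<bar> * \<bar>g t\<bar> \<le> exp (- (pi / 6) * t) * M" by (intro mult_mono) auto
    then show ?thesis by (simp add: h_def abs_mult mult.commute)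
  qed
  \<comment> \<open>Without integrability \<open>integral\<close> would take the default value 0,
    and the tail could not be split.\<close>
  have hi: "h integrable_on {c..}" if "0 < c" for c
  proof (rule measurable_bounded_by_integrable_imp_integrable_real)
    show "h \<in> borel_measurable (lebesgue_on {c..})"
      using that by (intro continuous_imp_measurable_on_sets_lebesgue continuous_on_subset[OF hc]) auto
    show "(\<lambda>t. M * exp (- (pi / 6) * t)) integrable_on {c..}"
      using integrable_on_exp_minus_to_infinity[of "pi / 6" c] by (intro integrable_on_mult_right) simp
  qed (use hb that in auto)
  have FG: "FG G m = complex_of_real (pi * integral {sqrt m..} h)" if "0 < m" for m
  proof -
    have "((\<lambda>t. complex_of_real (h t)) has_integral complex_of_real (integral {sqrt m..} h)) {sqrt m..}"
      using hi[of "sqrt m"] that by (intro has_integral_of_real integrable_integral) simp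
    also have "?this \<longleftrightarrow> ((\<lambda>t. (dedekind_eta (\<i> * of_real t / 2)) ^ 4 * of_real (G (rogers_ramanujan (exp (- pi * t)))))
      has_integral complex_of_real (integral {sqrt m..} h)) {sqrt m..}"
    proof (rule has_integral_cong)
      fix t assume "t \<in> {sqrt m..}"
      then have "0 < t" using that less_le_trans[of 0 "sqrt m" t] by simp
      then show "complex_of_real (h t) = (dedekind_eta (\<i> * of_real t / 2)) ^ 4 * of_real (G (rogers_ramanujan (exp (- pi * t))))"
        unfolding dedekind_eta_imaginary[OF \<open>0 < t\<close>] by (simp add: h_def e_def g_def)
    qed
    finally show ?thesis by (simp add: FG_def integral_unique)
  qed
  define D where "D = pi / (2 * k * (comp_mod k)\<^sup>2 * (ellN (comp_mod k))\<^sup>2)"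
  have "(period_ratio has_real_derivative - D) (at k)"
    using period_ratio_has_real_derivative[OF k(1,2)] by (simp add: D_def)
  \<comment> \<open>Two minus signs cancel: the tail shrinks as its lower end grows, and the period
    ratio decreases in k.\<close>
  then have "((\<lambda>k. pi * integral {period_ratio k..} h) has_real_derivative
      pi * (- h (period_ratio k) * - D)) (at k)"
    by (intro DERIV_cmult DERIV_chain2[OF integral_tail_has_real_derivative[OF hc hi]] period_ratio_pos k)
  also have "pi * (- h (period_ratio k) * - D) = (pi * e (period_ratio k) * D) * g (period_ratio k)"
    by (simp add: h_def)
  also have "pi * e (period_ratio k) * D = root 3 2 / (k * comp_mod k) powr (2/3)"
    unfolding e_def D_def using eta_period_ratio_identity[OF k(1,2) refl] by simp
  finally have "((\<lambda>k. complex_of_real (pi * integral {period_ratio k..} h)) has_vector_derivative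
      complex_of_real (root 3 2 / (k * comp_mod k) powr (2/3) * g (period_ratio k))) (at k)"
    by (intro has_vector_derivative_of_real) (simp add: has_real_derivative_iff_has_vector_derivative)
  then have "((\<lambda>k. FG G (sing_mod_inv k)) has_vector_derivative
      complex_of_real (root 3 2 / (k * comp_mod k) powr (2/3) * g (period_ratio k))) (at k)"
  \<comment> \<open>\<open>sing_mod_inv x\<close> is the square of the period ratio for x in (0, 1),
    an open set around k; the square root in \<open>FG\<close> undoes the square.\<close>
  proof (rule has_vector_derivative_transform_within_open[where S = "{0<..<1}"])
    fix x :: real assume "x \<in> {0<..<1}"
    then have x: "0 < x" "x < 1" by auto
    show "complex_of_real (pi * integral {period_ratio x..} h) = FG G (sing_mod_inv x)"
      using FG[of "(period_ratio x)\<^sup>2"] period_ratio_pos[OF x] by (simp add: sing_mod_inv_eq[OF x])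
  qed (use k in auto)
  then show ?thesis
    unfolding k(3) g_def by (simp add: k_def comp_mod_def)
qed

end
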